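(* Let $a,b\in\mathbb{R}$ be fixed with $ab<0$, and define $$c:=\frac{\pi b}{b-a},\qquad \mu_1:=\frac{c}{\sin(c)},\qquad \mu_2:=\frac{1}{\cos(c/2)}.$$ Then $0<\mu_2<\mu_1$ and, for each $\mu\in\mathbb{R}$, there exists a value $\varepsilon_0(\mu)>0$ such that, whenever $0<|\varepsilon|<\varepsilon_0(\mu)$: (1) if $0\le|\mu|<\mu_2$, then the equation $x'=\varepsilon f(x)+\mu\sin t$ has exactly three limit cycles; (2) if $\mu_2<|\mu|<\mu_1$, then the equation $x'=\varepsilon f(x)+\mu\sin t$ has exactly five limit cycles; (3) if $|\mu|>\mu_1$, then the equation $x'=\varepsilon f(x)+\mu\sin t$ has exactly one limit cycle.
   Context: For $a,b\in\mathbb{R}$, the function $f:\mathbb{R}\to\mathbb{R}$ is the continuous odd piecewise linear function $$f(x)=\begin{cases} ax+(a-b), & x\le -1,\\ bx, & -1<x<1,\\ ax+(b-a), & x\ge 1.\end{cases}$$ For real $\mu,\varepsilon$, consider the scalar $2\pi$-periodic differential equation $x'=\varepsilon f(x)+\mu\sin t$, whose solutions are all defined on $\mathbb{R}$. "Periodic solution" means $2\pi$-periodic solution (constant solutions are included). A limit cycle is an isolated periodic solution, i.e. its value $x$ at $t=0$ is an isolated zero of the displacement function $d(x)=u(2\pi,x)-x$, where $u(t,x)$ is the solution with $u(0,x)=x$. *)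

theory Defs
  imports "HOL-Analysis.Analysis"
begin

definition pwl :: "real \<Rightarrow> real \<Rightarrow> real \<Rightarrow> real" where
  "pwl a b x =
     (if x \<le> -1 then a * x + (a - b)
      else if x < 1 then b * x
      else a * x + (b - a))"

definition is_solution :: "real \<Rightarrow> real \<Rightarrow> real \<Rightarrow> real \<Rightarrow> (real \<Rightarrow> real) \<Rightarrow> bool" where
  "is_solution a b \<epsilon> \<mu> u \<longleftrightarrow>
     (\<forall>t. (u has_real_derivative \<epsilon> * pwl a b (u t) + \<mu> * sin t) (at t))"

text \<open>The right-hand side of the equation is continuous and globally Lipschitz in the unknown,
  so there is exactly one global solution with a given value at time 0 and the definite
  description below is well defined.\<close>

definition sol :: "real \<Rightarrow> real \<Rightarrow> real \<Rightarrow> real \<Rightarrow> real \<Rightarrow> real \<Rightarrow> real" where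
  "sol a b \<epsilon> \<mu> t x = (THE u. is_solution a b \<epsilon> \<mu> u \<and> u 0 = x) t"

definition displacement :: "real \<Rightarrow> real \<Rightarrow> real \<Rightarrow> real \<Rightarrow> real \<Rightarrow> real" where
  "displacement a b \<epsilon> \<mu> x = sol a b \<epsilon> \<mu> (2 * pi) x - x"

definition periodic_solution :: "real \<Rightarrow> real \<Rightarrow> real \<Rightarrow> real \<Rightarrow> (real \<Rightarrow> real) \<Rightarrow> bool" where
  "periodic_solution a b \<epsilon> \<mu> u \<longleftrightarrow>
     is_solution a b \<epsilon> \<mu> u \<and> (\<forall>t. u (t + 2 * pi) = u t)"

definition limit_cycle :: "real \<Rightarrow> real \<Rightarrow> real \<Rightarrow> real \<Rightarrow> (real \<Rightarrow> real) \<Rightarrow> bool" where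
  "limit_cycle a b \<epsilon> \<mu> u \<longleftrightarrow>
     periodic_solution a b \<epsilon> \<mu> u \<and> u 0 isolated_in {x. displacement a b \<epsilon> \<mu> x = 0}"

end

theory Submission
  imports Defs
begin

text \<open>
  After normalising \<open>b - a = 1\<close>, the coordinate \<open>y = x + \<mu> cos t\<close> turns the equation into
  \<open>y' = e f(y - \<mu> cos t)\<close>, so for small \<open>e\<close> the displacement is \<open>e\<close> times the average
  \<open>A(y)\<close> of \<open>f(y - \<mu> cos t)\<close> over a period, up to \<open>O(e\<^sup>2)\<close>. As \<open>f\<close> is not differentiable,
  simple zeros are controlled through the logarithm of the difference \<open>W\<close> of two solutions:
  \<open>(ln W)'\<close> is \<open>e\<close> times a difference quotient of \<open>f\<close>, whose integral over a period is close to
  \<open>A'(y)\<close>. Hence, if all zeros of \<open>A\<close> are simple, each continues to exactly one limit cycle and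
  there are no others.

  With \<open>\<alpha>(y)\<close> the measure of the times in \<open>[0, \<pi>]\<close> at which \<open>y + \<mu> cos t > 1\<close>, one has
  \<open>A'(y) / 2 = c - \<alpha>(y) - \<alpha>(-y)\<close> for \<open>\<mu> > 0\<close>. On \<open>y \<ge> 0\<close> the sum \<open>\<alpha>(y) + \<alpha>(-y)\<close>
  decreases up to \<open>y = \<mu> - 1\<close> and is nondecreasing afterwards. So the number of zeros of the odd
  function \<open>A\<close> is determined by the signs of \<open>A'(0)\<close>, which changes at \<open>\<mu>\<^sub>2\<close>, and of its local maximum
  \<open>A(1 - \<mu> cos c) = 2 (c - \<mu> sin c)\<close>, which changes at \<open>\<mu>\<^sub>1\<close>.
\<close>

subsection \<open>Global existence for Lipschitz equations\<close>

text \<open>Integrating \<open>exp (K * \<bar>t\<bar>)\<close> gains a factor \<open>1 / K\<close>.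
  In the norm weighted by this exponential, that factor is what makes the Picard map a
  contraction.\<close>

lemma bound_by_exp_of_deriv:
  fixes G g :: "real \<Rightarrow> real"
  assumes G: "\<And>t. (G has_real_derivative g t) (at t)" and G0: "G 0 = 0"
    and g: "\<And>t. \<bar>g t\<bar> \<le> C * exp (K * \<bar>t\<bar>)" and K: "K > 0"
  shows "\<bar>G t\<bar> \<le> C / K * exp (K * \<bar>t\<bar>)"
proof -
  have C: "C \<ge> 0" using g[of 0] by simp
  have nonneg: "H t \<le> C / K * exp (K * t)"
    if H: "\<And>t. (H has_real_derivative h t) (at t)" and H0: "H 0 = 0"
      and h: "\<And>t. \<bar>h t\<bar> \<le> C * exp (K * \<bar>t\<bar>)" and t: "t \<ge> 0" for H h :: "real \<Rightarrow> real" and t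
  proof -
    have "(\<lambda>s. C / K * exp (K * s) - H s) 0 \<le> (\<lambda>s. C / K * exp (K * s) - H s) t"
    proof (rule DERIV_nonneg_imp_nondecreasing[OF t], rule exI, rule conjI)
      fix s :: real assume s: "0 \<le> s"
      show "((\<lambda>s. C / K * exp (K * s) - H s) has_real_derivative C * exp (K * s) - h s) (at s)"
        using K by (auto intro!: derivative_eq_intros H)
      show "C * exp (K * s) - h s \<ge> 0" using h[of s] s by simp
    qed
    moreover have "C / K \<ge> 0" using C K by simp
    ultimately show ?thesis using H0 by simp
  qed
  have minus: "((\<lambda>s. G (- s)) has_real_derivative - g (- s)) (at s)" for s
    using G by (simp flip: DERIV_mirror)
  show ?thesis
  proof (cases "t \<ge> 0")
    case True
    then show ?thesis
      using nonneg[OF G G0 g, of t] nonneg[of "\<lambda>t. - G t" "\<lambda>t. - g t" t] G G0 g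
      by (auto intro!: derivative_intros simp: abs_le_iff)
  next
    case False
    have g': "\<bar>- g (- s)\<bar> \<le> C * exp (K * \<bar>s\<bar>)" for s using g[of "- s"] by simp
    have "((\<lambda>s. - G (- s)) has_real_derivative g (- s)) (at s)" for s
      using DERIV_minus[OF minus] by simp
    then show ?thesis
      using False nonneg[OF minus _ g', of "- t"] nonneg[of "\<lambda>s. - G (- s)" "\<lambda>s. g (- s)" "- t"] g' G0
      by (auto simp: abs_le_iff)
  qed
qed

text \<open>Since \<open>w\<close> may change sign, the argument runs on its square:
  \<open>w\<^sup>2 * exp (- 2 * k * t)\<close> is nonincreasing for \<open>t \<ge> 0\<close>.
  Negative times follow by reflection.\<close>

lemma linear_gronwall:
  fixes w w' :: "real \<Rightarrow> real"
  assumes w: "\<And>t. (w has_real_derivative w' t) (at t)" and le: "\<And>t. \<bar>w' t\<bar> \<le> k * \<bar>w t\<bar>"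
  shows "\<bar>w t\<bar> \<le> \<bar>w 0\<bar> * exp (k * \<bar>t\<bar>)"
proof -
  have nonneg: "\<bar>v t\<bar> \<le> \<bar>v 0\<bar> * exp (k * t)"
    if v: "\<And>t. (v has_real_derivative v' t) (at t)" and le: "\<And>t. \<bar>v' t\<bar> \<le> k * \<bar>v t\<bar>" and t: "t \<ge> 0"
    for v v' :: "real \<Rightarrow> real" and t
  proof -
    have "(\<lambda>s. (v s)\<^sup>2 * exp (- 2 * k * s)) t \<le> (\<lambda>s. (v s)\<^sup>2 * exp (- 2 * k * s)) 0"
    proof (rule DERIV_nonpos_imp_nonincreasing[OF t], rule exI, rule conjI)
      fix s
      show "((\<lambda>s. (v s)\<^sup>2 * exp (- 2 * k * s)) has_real_derivative
              2 * (v s * v' s - k * (v s)\<^sup>2) * exp (- 2 * k * s)) (at s)"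
        by (auto intro!: derivative_eq_intros v simp: algebra_simps power2_eq_square)
      have "v s * v' s \<le> \<bar>v s\<bar> * \<bar>v' s\<bar>" by (metis abs_ge_self abs_mult)
      also have "\<dots> \<le> \<bar>v s\<bar> * (k * \<bar>v s\<bar>)" by (intro mult_left_mono le) auto
      also have "\<dots> = k * (v s)\<^sup>2" by (simp add: power2_eq_square)
      finally show "2 * (v s * v' s - k * (v s)\<^sup>2) * exp (- 2 * k * s) \<le> 0"
        by (simp add: mult_le_0_iff)
    qed
    then have "(v t)\<^sup>2 * exp (- 2 * k * t) * exp (2 * k * t) \<le> (v 0)\<^sup>2 * exp (2 * k * t)"
      by (intro mult_right_mono) auto
    then have "(v t)\<^sup>2 \<le> (v 0)\<^sup>2 * exp (2 * k * t)" by (simp add: mult.assoc flip: exp_add)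
    also have "\<dots> = (\<bar>v 0\<bar> * exp (k * t))\<^sup>2" by (simp add: power_mult_distrib flip: exp_double)
    finally show ?thesis by (metis abs_ge_zero abs_le_square_iff abs_mult abs_abs abs_of_nonneg exp_ge_zero mult_nonneg_nonneg)
  qed
  have minus: "((\<lambda>s. w (- s)) has_real_derivative - w' (- s)) (at s)" for s
    using w by (simp flip: DERIV_mirror)
  show ?thesis
    using nonneg[OF w le, of t] nonneg[OF minus, of "- t"] le by (cases "t \<ge> 0") auto
qed

lemma ode_global_existence:
  fixes \<phi> :: "real \<Rightarrow> real \<Rightarrow> real"
  assumes cont: "continuous_on UNIV (\<lambda>(t, x). \<phi> t x)"
    and lip: "\<And>t x y. \<bar>\<phi> t x - \<phi> t y\<bar> \<le> L * \<bar>x - y\<bar>" and bd: "\<And>t. \<bar>\<phi> t 0\<bar> \<le> C"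
  shows "\<exists>u. u 0 = x \<and> (\<forall>t. (u has_real_derivative \<phi> t (u t)) (at t))"
proof -
  have L: "L \<ge> 0" using lip[of 0 1 0] by simp
  have C: "C \<ge> 0" using bd[of 0] by simp
  \<comment> \<open>The Picard map is a contraction for the supremum norm with weight \<open>exp (- K \<bar>t\<bar>)\<close>, \<open>K > L\<close>;
    \<open>apply_bcontfun z\<close> stands for the weighted deviation \<open>exp (- K \<bar>t\<bar>) (u t - x)\<close>.\<close>
  define K where "K = L + 1"
  have K: "K > 0" using L by (simp add: K_def)
  define g where "g z s = \<phi> s (x + exp (K * \<bar>s\<bar>) * apply_bcontfun z s)" for z s
  have cz: "continuous_on UNIV (apply_bcontfun z)" for z :: "real \<Rightarrow>\<^sub>C real"
    using apply_bcontfun by (auto simp: bcontfun_def)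
  have contg: "continuous_on UNIV (g z)" for z
  proof -
    have "continuous_on UNIV (\<lambda>s. (\<lambda>(t, x). \<phi> t x) (s, x + exp (K * \<bar>s\<bar>) * apply_bcontfun z s))"
      by (rule continuous_on_compose2[OF cont]) (auto intro!: continuous_intros cz)
    then show ?thesis by (simp add: g_def[abs_def])
  qed
  have "\<exists>G. G 0 = 0 \<and> (\<forall>t. (G has_real_derivative g z t) (at t))" for z
  proof -
    obtain H where H: "\<And>t. (H has_vector_derivative g z t) (at t)"
      using einterval_antiderivative[of "-\<infinity>" "\<infinity>" "g z"] contg[of z]
      by (auto simp: continuous_on_eq_continuous_at)
    then show ?thesis
      by (intro exI[of _ "\<lambda>t. H t - H 0"])
        (auto intro!: derivative_eq_intros simp: has_real_derivative_iff_has_vector_derivative)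
  qed
  then obtain G where G0: "\<And>z. G z 0 = 0" and G: "\<And>z t. (G z has_real_derivative g z t) (at t)"
    by metis
  have nz: "\<bar>apply_bcontfun z s\<bar> \<le> norm z" for z :: "real \<Rightarrow>\<^sub>C real" and s
    using norm_bounded[of z s] by simp
  have gb: "\<bar>g z s\<bar> \<le> (C + L * (\<bar>x\<bar> + norm z)) * exp (K * \<bar>s\<bar>)" for z s
  proof -
    \<comment> \<open>As the weight is at least 1, the constant contributions of \<open>C\<close>
      and \<open>x\<close> can be put under the same exponential as the contribution of
      \<open>z\<close>.\<close>
    have E: "1 \<le> exp (K * \<bar>s\<bar>)" using K by simp
    have "\<bar>g z s\<bar> \<le> C + L * \<bar>x + exp (K * \<bar>s\<bar>) * apply_bcontfun z s\<bar>"
      using lip[of s "x + exp (K * \<bar>s\<bar>) * apply_bcontfun z s" 0] bd[of s] by (simp add: g_def)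
    also have "\<bar>x + exp (K * \<bar>s\<bar>) * apply_bcontfun z s\<bar> \<le> \<bar>x\<bar> + exp (K * \<bar>s\<bar>) * norm z"
      using nz[of z s] by (intro order_trans[OF abs_triangle_ineq] add_mono) (auto simp: abs_mult)
    also have "\<dots> \<le> exp (K * \<bar>s\<bar>) * (\<bar>x\<bar> + norm z)"
      using mult_right_mono[OF E, of "\<bar>x\<bar>"] by (simp add: algebra_simps)
    finally have "\<bar>g z s\<bar> \<le> C + L * (exp (K * \<bar>s\<bar>) * (\<bar>x\<bar> + norm z))"
      using L by (simp add: mult_left_mono)
    moreover have "C \<le> C * exp (K * \<bar>s\<bar>)" using mult_left_mono[OF E C] by simp
    ultimately show ?thesis by (simp add: algebra_simps)
  qed
  define h where "h z t = exp (- (K * \<bar>t\<bar>)) * G z t" for z t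
  have hb: "h z \<in> bcontfun" for z
  proof (rule bcontfun_normI)
    show "continuous_on UNIV (h z)"
      unfolding h_def
      by (intro continuous_intros continuous_at_imp_continuous_on ballI DERIV_isCont[OF G])
    fix t
    have "\<bar>G z t\<bar> \<le> (C + L * (\<bar>x\<bar> + norm z)) / K * exp (K * \<bar>t\<bar>)"
      by (rule bound_by_exp_of_deriv[OF G G0 gb K])
    then have "exp (- (K * \<bar>t\<bar>)) * \<bar>G z t\<bar> \<le>
        exp (- (K * \<bar>t\<bar>)) * ((C + L * (\<bar>x\<bar> + norm z)) / K * exp (K * \<bar>t\<bar>))"
      by (intro mult_left_mono) auto
    also have "\<dots> = (C + L * (\<bar>x\<bar> + norm z)) / K" by (simp add: exp_minus)
    finally show "norm (h z t) \<le> (C + L * (\<bar>x\<bar> + norm z)) / K" by (simp add: h_def abs_mult)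
  qed
  define T where "T z = Bcontfun (h z)" for z
  have Tz: "apply_bcontfun (T z) = h z" for z
    by (simp add: T_def Bcontfun_inverse[OF hb])
  have "\<exists>!z. T z = z"
  proof (rule banach_fix_type[of "L / K"])
    show "0 \<le> L / K" "L / K < 1" using L K by (auto simp: K_def)
    show "\<forall>z w. dist (T z) (T w) \<le> L / K * dist z w"
    proof (intro allI dist_bound)
      fix z w :: "real \<Rightarrow>\<^sub>C real" and t
      have "\<bar>G z t - G w t\<bar> \<le> L * dist z w / K * exp (K * \<bar>t\<bar>)"
      proof (rule bound_by_exp_of_deriv[of "\<lambda>t. G z t - G w t" "\<lambda>t. g z t - g w t"])
        fix s
        show "((\<lambda>t. G z t - G w t) has_real_derivative g z s - g w s) (at s)"
          by (intro derivative_intros G)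
        have "\<bar>g z s - g w s\<bar> \<le> L * \<bar>exp (K * \<bar>s\<bar>) * (apply_bcontfun z s - apply_bcontfun w s)\<bar>"
          using lip[of s "x + exp (K * \<bar>s\<bar>) * apply_bcontfun z s" "x + exp (K * \<bar>s\<bar>) * apply_bcontfun w s"]
          by (simp add: g_def algebra_simps)
        also have "\<dots> \<le> L * (exp (K * \<bar>s\<bar>) * dist z w)"
          using L dist_bounded[of z s w]
          by (intro mult_left_mono) (auto simp: abs_mult dist_real_def)
        finally show "\<bar>g z s - g w s\<bar> \<le> L * dist z w * exp (K * \<bar>s\<bar>)" by (simp add: algebra_simps)
      qed (auto simp: G0 K)
      then have "exp (- (K * \<bar>t\<bar>)) * \<bar>G z t - G w t\<bar> \<le>
          exp (- (K * \<bar>t\<bar>)) * (L * dist z w / K * exp (K * \<bar>t\<bar>))"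
        by (intro mult_left_mono) auto
      also have "\<dots> = L / K * dist z w" by (simp add: exp_minus)
      finally show "dist (apply_bcontfun (T z) t) (apply_bcontfun (T w) t) \<le> L / K * dist z w"
        by (simp add: Tz h_def dist_real_def abs_mult flip: right_diff_distrib)
    qed
  qed
  then obtain z where z: "T z = z" by blast
  \<comment> \<open>Removing the weight at the fixed point shows that \<open>x + G z t\<close>
    satisfies the integral form of the equation.\<close>
  have "apply_bcontfun z t = exp (- (K * \<bar>t\<bar>)) * G z t" for t
    using Tz[of z] by (simp add: z h_def)
  then have "exp (K * \<bar>t\<bar>) * apply_bcontfun z t = G z t" for t by (simp add: exp_minus)
  then have "g z t = \<phi> t (x + G z t)" for t by (simp add: g_def)
  then have "((\<lambda>t. x + G z t) has_real_derivative \<phi> t (x + G z t)) (at t)" for t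
    using G[of z t] by (auto intro!: derivative_eq_intros)
  then show ?thesis using G0 by (intro exI[of _ "\<lambda>t. x + G z t"]) auto
qed

subsection \<open>Solutions of the piecewise linear equation\<close>

text \<open>A linear function minus two ramps: all later estimates and integrals of
  \<open>pwl\<close> reduce to the convex function \<open>max 0\<close>.\<close>

lemma pwl_eq: "pwl a b x = b * x - (b - a) * (max 0 (x - 1) - max 0 (- x - 1))"
  by (auto simp: pwl_def max_def algebra_simps)

lemma continuous_on_pwl [continuous_intros]:
  "continuous_on S g \<Longrightarrow> continuous_on S (\<lambda>x. pwl a b (g x))"
  unfolding pwl_eq by (intro continuous_intros)

text \<open>A crude constant valid for all \<open>a\<close> and \<open>b\<close>, enough for
  existence and uniqueness; averaging uses the constant 1 of the normalised case.\<close>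

lemma pwl_lipschitz: "\<bar>pwl a b x - pwl a b y\<bar> \<le> (2 * \<bar>a\<bar> + 3 * \<bar>b\<bar>) * \<bar>x - y\<bar>"
proof -
  have "pwl a b x - pwl a b y =
      b * (x - y) - (b - a) * ((max 0 (x - 1) - max 0 (y - 1)) - (max 0 (- x - 1) - max 0 (- y - 1)))"
    by (simp add: pwl_eq algebra_simps)
  also have "\<bar>\<dots>\<bar> \<le> \<bar>b\<bar> * \<bar>x - y\<bar> + \<bar>b - a\<bar> * (2 * \<bar>x - y\<bar>)"
    unfolding max_def by (intro order_trans[OF abs_triangle_ineq4] add_mono) (auto simp: abs_mult intro!: mult_left_mono)
  also have "\<dots> \<le> \<bar>b\<bar> * \<bar>x - y\<bar> + (\<bar>b\<bar> + \<bar>a\<bar>) * (2 * \<bar>x - y\<bar>)"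
    by (intro add_mono mult_right_mono) auto
  finally show ?thesis by (simp add: algebra_simps)
qed

text \<open>The common value may be taken at any time \<open>s\<close>: later this also excludes
  crossings of distinct solutions. Shifting time by \<open>s\<close> reduces to the linear Gronwall
  bound for the difference.\<close>

lemma is_solution_unique:
  assumes u: "is_solution a b \<epsilon> \<mu> u" and v: "is_solution a b \<epsilon> \<mu> v" and "u s = v s"
  shows "u = v"
proof
  fix t
  define k where "k = \<bar>\<epsilon>\<bar> * (2 * \<bar>a\<bar> + 3 * \<bar>b\<bar>)"
  have d: "((\<lambda>r. u (r + s) - v (r + s)) has_real_derivative \<epsilon> * (pwl a b (u (r + s)) - pwl a b (v (r + s)))) (at r)" for r
    using u v unfolding is_solution_def
    by (auto intro!: derivative_eq_intros DERIV_chain2[of u] DERIV_chain2[of v] simp: algebra_simps)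
  have "\<bar>u ((t - s) + s) - v ((t - s) + s)\<bar> \<le> \<bar>u (0 + s) - v (0 + s)\<bar> * exp (k * \<bar>t - s\<bar>)"
    by (rule linear_gronwall[OF d, where k = k])
      (auto simp: abs_mult k_def mult.assoc intro!: mult_left_mono pwl_lipschitz)
  with \<open>u s = v s\<close> show "u t = v t" by simp
qed

lemma is_solution_exists: "\<exists>u. is_solution a b \<epsilon> \<mu> u \<and> u 0 = x"
proof -
  have "\<exists>u. u 0 = x \<and> (\<forall>t. (u has_real_derivative \<epsilon> * pwl a b (u t) + \<mu> * sin t) (at t))"
  proof (rule ode_global_existence)
    show "continuous_on UNIV (\<lambda>(t, x). \<epsilon> * pwl a b x + \<mu> * sin t)"
      by (auto simp: case_prod_unfold intro!: continuous_intros)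
    fix t x y :: real
    have "\<bar>\<epsilon> * pwl a b x - \<epsilon> * pwl a b y\<bar> \<le> \<bar>\<epsilon>\<bar> * ((2 * \<bar>a\<bar> + 3 * \<bar>b\<bar>) * \<bar>x - y\<bar>)"
      by (auto simp: abs_mult simp flip: right_diff_distrib intro!: mult_left_mono pwl_lipschitz)
    then show "\<bar>(\<epsilon> * pwl a b x + \<mu> * sin t) - (\<epsilon> * pwl a b y + \<mu> * sin t)\<bar> \<le>
        \<bar>\<epsilon>\<bar> * (2 * \<bar>a\<bar> + 3 * \<bar>b\<bar>) * \<bar>x - y\<bar>" by (simp add: mult.assoc)
    show "\<bar>\<epsilon> * pwl a b 0 + \<mu> * sin t\<bar> \<le> \<bar>\<mu>\<bar>"
      by (simp add: pwl_def abs_mult mult_left_le)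
  qed
  then show ?thesis by (auto simp: is_solution_def)
qed

lemma sol_eqI:
  assumes "is_solution a b \<epsilon> \<mu> u"
  shows "sol a b \<epsilon> \<mu> t (u 0) = u t"
proof -
  have "(THE v. is_solution a b \<epsilon> \<mu> v \<and> v 0 = u 0) = u"
    using assms is_solution_unique by (intro the_equality) auto
  then show ?thesis by (simp add: sol_def)
qed

lemma is_solution_sol: "is_solution a b \<epsilon> \<mu> (\<lambda>t. sol a b \<epsilon> \<mu> t x)"
proof -
  obtain u where u: "is_solution a b \<epsilon> \<mu> u" "u 0 = x" using is_solution_exists by blast
  then have "(\<lambda>t. sol a b \<epsilon> \<mu> t x) = u" using sol_eqI by blast
  with u show ?thesis by simp
qed

lemma sol_0 [simp]: "sol a b \<epsilon> \<mu> 0 x = x"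
  using is_solution_exists[of a b \<epsilon> \<mu> x] sol_eqI by blast

text \<open>The translate of a solution by \<open>2 * pi\<close> is again a solution because the
  forcing is periodic. If the two agree at time 0, they agree everywhere by uniqueness.\<close>

lemma periodic_solution_iff:
  "periodic_solution a b \<epsilon> \<mu> u \<longleftrightarrow> is_solution a b \<epsilon> \<mu> u \<and> displacement a b \<epsilon> \<mu> (u 0) = 0"
proof -
  have "u (t + 2 * pi) = u t" if u: "is_solution a b \<epsilon> \<mu> u" and "u (2 * pi) = u 0" for t
  proof -
    have "is_solution a b \<epsilon> \<mu> (\<lambda>t. u (t + 2 * pi))"
      using u unfolding is_solution_def
      by (simp flip: DERIV_shift) (metis sin_periodic)
    from is_solution_unique[OF this u, of 0] that(2) show ?thesis by (simp add: fun_eq_iff)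
  qed
  moreover have "displacement a b \<epsilon> \<mu> (u 0) = u (2 * pi) - u 0" if "is_solution a b \<epsilon> \<mu> u"
    using that by (simp add: displacement_def sol_eqI)
  ultimately show ?thesis
    unfolding periodic_solution_def by (metis add.left_neutral cancel_comm_monoid_add_class.diff_cancel eq_iff_diff_eq_0)
qed

text \<open>In a finite zero set every zero is isolated, so evaluation at time 0 is a bijection from
  limit cycles to zeros.\<close>

lemma card_limit_cycles:
  assumes "finite {x. displacement a b \<epsilon> \<mu> x = 0}"
  shows "card {u. limit_cycle a b \<epsilon> \<mu> u} = card {x. displacement a b \<epsilon> \<mu> x = 0}"
proof -
  have iso: "x isolated_in {x. displacement a b \<epsilon> \<mu> x = 0}" if "displacement a b \<epsilon> \<mu> x = 0" for x
    using that assms by (simp add: isolated_in_islimpt_iff islimpt_finite)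
  have "bij_betw (\<lambda>u. u 0) {u. limit_cycle a b \<epsilon> \<mu> u} {x. displacement a b \<epsilon> \<mu> x = 0}"
  proof (rule bij_betwI')
    show "\<exists>u\<in>{u. limit_cycle a b \<epsilon> \<mu> u}. x = u 0" if "x \<in> {x. displacement a b \<epsilon> \<mu> x = 0}" for x
      using that iso is_solution_sol
      by (intro bexI[of _ "\<lambda>t. sol a b \<epsilon> \<mu> t x"]) (auto simp: limit_cycle_def periodic_solution_iff)
  qed (use is_solution_unique in \<open>auto simp: limit_cycle_def periodic_solution_iff\<close>)
  then show ?thesis by (rule bij_betw_same_card)
qed

text \<open>\<open>pwl\<close> is homogeneous of degree one in the pair of slopes, so the factor
  \<open>b - a\<close> can be moved into \<epsilon>. It may be negative, so both signs of the small
  parameter must be handled.\<close>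

lemma limit_cycle_normalize:
  assumes "a \<noteq> b"
  shows "limit_cycle a b \<epsilon> \<mu> = limit_cycle (b / (b - a) - 1) (b / (b - a)) (\<epsilon> * (b - a)) \<mu>"
proof -
  have "pwl a b x = (b - a) * pwl (b / (b - a) - 1) (b / (b - a)) x" for x
    using assms by (simp add: pwl_eq right_diff_distrib)
  then have "is_solution a b \<epsilon> \<mu> = is_solution (b / (b - a) - 1) (b / (b - a)) (\<epsilon> * (b - a)) \<mu>"
    by (simp add: is_solution_def fun_eq_iff mult.assoc)
  then show ?thesis
    by (simp add: limit_cycle_def fun_eq_iff periodic_solution_def displacement_def sol_def)
qed

subsection \<open>Averaging\<close>

text \<open>Both slopes \<open>b - 1\<close> and \<open>b\<close> lie between -1 and 1. In the proof
  the increment is a difference of two numbers in the interval from 0 to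
  \<open>y - x\<close>.\<close>

lemma pwl_lipschitz_unit:
  assumes "0 < b" "b < 1"
  shows "\<bar>pwl (b - 1) b x - pwl (b - 1) b y\<bar> \<le> \<bar>x - y\<bar>"
proof (induction x y rule: linorder_wlog)
  case (le x y)
  define d where "d = (max 0 (y - 1) - max 0 (- y - 1)) - (max 0 (x - 1) - max 0 (- x - 1))"
  have d: "0 \<le> d" "d \<le> y - x" using le by (auto simp: d_def max_def)
  have "pwl (b - 1) b y - pwl (b - 1) b x = b * (y - x) - d"
    by (simp add: pwl_eq d_def algebra_simps)
  moreover have "0 \<le> b * (y - x)" "b * (y - x) \<le> y - x"
    using le assms by (auto simp: mult_left_le_one_le)
  ultimately show ?case using d by linarith
qed (simp add: abs_minus_commute)

lemma pwl_abs_le: "0 < b \<Longrightarrow> b < 1 \<Longrightarrow> \<bar>pwl (b - 1) b x\<bar> \<le> \<bar>x\<bar>"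
  using pwl_lipschitz_unit[of b x 0] by (simp add: pwl_def)

text \<open>In the coordinate \<open>y = x + \<mu> cos t\<close> the equation reads \<open>y' = e f(y - \<mu> cos t)\<close>, which
  is small of order \<open>e\<close>.\<close>

definition slow :: "real \<Rightarrow> real \<Rightarrow> real \<Rightarrow> real \<Rightarrow> real \<Rightarrow> real" where
  "slow b e \<mu> y t = sol (b - 1) b e \<mu> t (y - \<mu>) + \<mu> * cos t"

abbreviation slow_displacement :: "real \<Rightarrow> real \<Rightarrow> real \<Rightarrow> real \<Rightarrow> real" where
  "slow_displacement b e \<mu> y \<equiv> displacement (b - 1) b e \<mu> (y - \<mu>)"

lemma slow_0 [simp]: "slow b e \<mu> y 0 = y"
  by (simp add: slow_def)

lemma slow_displacement_eq: "slow_displacement b e \<mu> y = slow b e \<mu> y (2 * pi) - y"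
  by (simp add: slow_def displacement_def)

lemma has_derivative_slow:
  "(slow b e \<mu> y has_real_derivative e * pwl (b - 1) b (slow b e \<mu> y t - \<mu> * cos t)) (at t)"
  using is_solution_sol[of "b - 1" b e \<mu> "y - \<mu>"] unfolding is_solution_def slow_def[abs_def]
  by (auto intro!: derivative_eq_intros)

lemma continuous_on_slow [continuous_intros]: "continuous_on S (slow b e \<mu> y)"
  by (intro continuous_at_imp_continuous_on ballI DERIV_isCont[OF has_derivative_slow])

text \<open>The maximal deviation \<open>M\<close> over a period bounds its own growth: the mean
  value theorem gives \<open>M \<le> 2 * pi * \<bar>e\<bar> * (M + \<bar>y\<bar> +
  \<bar>\<mu>\<bar>)\<close>, and the smallness of \<open>e\<close> allows half of \<open>M\<close>
  to be absorbed on the left.\<close>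

lemma slow_close:
  assumes b: "0 < b" "b < 1" and e: "4 * pi * \<bar>e\<bar> \<le> 1" and t: "t \<in> {0..2 * pi}"
  shows "\<bar>slow b e \<mu> y t - y\<bar> \<le> 4 * pi * \<bar>e\<bar> * (\<bar>y\<bar> + \<bar>\<mu>\<bar>)"
proof -
  have "continuous_on {0..2 * pi} (\<lambda>t. \<bar>slow b e \<mu> y t - y\<bar>)"
    by (intro continuous_intros)
  then obtain t0 where t0: "t0 \<in> {0..2 * pi}"
    and max: "\<And>s. s \<in> {0..2 * pi} \<Longrightarrow> \<bar>slow b e \<mu> y s - y\<bar> \<le> \<bar>slow b e \<mu> y t0 - y\<bar>"
    using continuous_attains_sup[of "{0..2 * pi}"] t by (metis compact_Icc empty_iff)
  define M where "M = \<bar>slow b e \<mu> y t0 - y\<bar>"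
  have "M \<le> 2 * pi * \<bar>e\<bar> * (M + \<bar>y\<bar> + \<bar>\<mu>\<bar>)"
  proof (cases "t0 = 0")
    case False
    then have "0 < t0" using t0 by simp
    from MVT2[OF this has_derivative_slow, of b e \<mu> y] obtain s where s: "0 < s" "s < t0"
      and eq: "slow b e \<mu> y t0 - y = t0 * (e * pwl (b - 1) b (slow b e \<mu> y s - \<mu> * cos s))"
      by auto
    have "\<bar>pwl (b - 1) b (slow b e \<mu> y s - \<mu> * cos s)\<bar> \<le> \<bar>slow b e \<mu> y s - \<mu> * cos s\<bar>"
      by (rule pwl_abs_le[OF b])
    also have "\<dots> \<le> \<bar>slow b e \<mu> y s - y\<bar> + \<bar>y\<bar> + \<bar>\<mu> * cos s\<bar>" by arith
    also have "\<dots> \<le> M + \<bar>y\<bar> + \<bar>\<mu>\<bar>"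
      using max[of s] s t0 by (intro add_mono) (auto simp: M_def abs_mult mult_left_le)
    finally have "\<bar>t0\<bar> * (\<bar>e\<bar> * \<bar>pwl (b - 1) b (slow b e \<mu> y s - \<mu> * cos s)\<bar>) \<le>
        (2 * pi) * (\<bar>e\<bar> * (M + \<bar>y\<bar> + \<bar>\<mu>\<bar>))"
      using t0 by (intro mult_mono) auto
    then show ?thesis unfolding M_def eq by (simp add: abs_mult mult.assoc)
  qed (simp add: M_def)
  moreover have "2 * pi * \<bar>e\<bar> * M \<le> M / 2"
    using mult_right_mono[OF e, of M] by (simp add: M_def)
  ultimately have "M \<le> 4 * pi * \<bar>e\<bar> * (\<bar>y\<bar> + \<bar>\<mu>\<bar>)" by (simp add: algebra_simps)
  with max[OF t] show ?thesis by (simp add: M_def)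
qed

lemma slow_displacement_integral:
  "((\<lambda>t. e * pwl (b - 1) b (slow b e \<mu> y t - \<mu> * cos t)) has_integral slow_displacement b e \<mu> y) {0..2 * pi}"
proof -
  have "((\<lambda>t. e * pwl (b - 1) b (slow b e \<mu> y t - \<mu> * cos t)) has_integral
      slow b e \<mu> y (2 * pi) - slow b e \<mu> y 0) {0..2 * pi}"
    by (rule fundamental_theorem_of_calculus)
      (auto simp flip: has_real_derivative_iff_has_vector_derivative intro: DERIV_subset has_derivative_slow)
  then show ?thesis by (simp add: slow_displacement_eq)
qed

text \<open>Not divided by the period, so that \<open>e * avg b \<mu> y\<close> is itself the
  first-order displacement.\<close>

definition avg :: "real \<Rightarrow> real \<Rightarrow> real \<Rightarrow> real" where
  "avg b \<mu> y = integral {0..2 * pi} (\<lambda>t. pwl (b - 1) b (y - \<mu> * cos t))"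

text \<open>Freezing the slow variable at \<open>y\<close> changes the integrand by at most
  \<open>\<bar>e\<bar>\<close> times the drift bounded in \<open>slow_close\<close>, which is itself
  of order \<open>e\<close>; integration multiplies this by \<open>2 * pi\<close>.\<close>

lemma slow_displacement_approx:
  assumes b: "0 < b" "b < 1" and e: "4 * pi * \<bar>e\<bar> \<le> 1"
  shows "\<bar>slow_displacement b e \<mu> y - e * avg b \<mu> y\<bar> \<le> 8 * pi\<^sup>2 * e\<^sup>2 * (\<bar>y\<bar> + \<bar>\<mu>\<bar>)"
proof -
  define B where "B = \<bar>e\<bar> * (4 * pi * \<bar>e\<bar> * (\<bar>y\<bar> + \<bar>\<mu>\<bar>))"
  have "((\<lambda>t. pwl (b - 1) b (y - \<mu> * cos t)) has_integral avg b \<mu> y) {0..2 * pi}"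
    unfolding avg_def by (intro integrable_integral integrable_continuous_interval continuous_intros)
  then have "((\<lambda>t. e * pwl (b - 1) b (slow b e \<mu> y t - \<mu> * cos t) - e * pwl (b - 1) b (y - \<mu> * cos t))
      has_integral slow_displacement b e \<mu> y - e * avg b \<mu> y) {0..2 * pi}"
    by (intro has_integral_diff slow_displacement_integral has_integral_mult_right)
  then have "((\<lambda>t. e * pwl (b - 1) b (slow b e \<mu> y t - \<mu> * cos t) - e * pwl (b - 1) b (y - \<mu> * cos t))
      has_integral slow_displacement b e \<mu> y - e * avg b \<mu> y) (cbox 0 (2 * pi))" by simp
  then have "norm (slow_displacement b e \<mu> y - e * avg b \<mu> y) \<le> B * measure lborel (cbox 0 (2 * pi))"
  proof (rule has_integral_bound[rotated])
    fix t assume t: "t \<in> cbox 0 (2 * pi)"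
    have "\<bar>e * (pwl (b - 1) b (slow b e \<mu> y t - \<mu> * cos t) - pwl (b - 1) b (y - \<mu> * cos t))\<bar> \<le>
        \<bar>e\<bar> * \<bar>slow b e \<mu> y t - y\<bar>"
      using pwl_lipschitz_unit[OF b, of "slow b e \<mu> y t - \<mu> * cos t" "y - \<mu> * cos t"]
      by (auto simp: abs_mult intro!: mult_left_mono)
    also have "\<dots> \<le> B"
      using slow_close[OF b e, of t] t unfolding B_def by (intro mult_left_mono) auto
    finally show "norm (e * pwl (b - 1) b (slow b e \<mu> y t - \<mu> * cos t) - e * pwl (b - 1) b (y - \<mu> * cos t)) \<le> B"
      by (simp add: right_diff_distrib)
  qed (simp add: B_def)
  moreover have "B * (2 * pi) = 8 * pi\<^sup>2 * (\<bar>e\<bar> * \<bar>e\<bar>) * (\<bar>y\<bar> + \<bar>\<mu>\<bar>)"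
    by (simp only: B_def power2_eq_square) simp
  ultimately show ?thesis by (simp add: power2_eq_square)
qed

text \<open>Gronwall bounds the dependence of the time-\<open>2 * pi\<close> value on the initial
  value; the summand 1 in the Lipschitz constant accounts for the subtracted identity.\<close>

lemma continuous_on_slow_displacement:
  assumes b: "0 < b" "b < 1"
  shows "continuous_on S (slow_displacement b e \<mu>)"
proof -
  have "(exp (\<bar>e\<bar> * (2 * pi)) + 1)-lipschitz_on S (slow_displacement b e \<mu>)"
  proof (rule lipschitz_onI)
    fix x y
    have "((\<lambda>t. slow b e \<mu> x t - slow b e \<mu> y t) has_real_derivative
        e * pwl (b - 1) b (slow b e \<mu> x t - \<mu> * cos t) - e * pwl (b - 1) b (slow b e \<mu> y t - \<mu> * cos t)) (at t)" for t
      by (intro derivative_intros has_derivative_slow)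
    moreover have "\<bar>e * pwl (b - 1) b (slow b e \<mu> x t - \<mu> * cos t) - e * pwl (b - 1) b (slow b e \<mu> y t - \<mu> * cos t)\<bar>
        \<le> \<bar>e\<bar> * \<bar>slow b e \<mu> x t - slow b e \<mu> y t\<bar>" for t
      using pwl_lipschitz_unit[OF b, of "slow b e \<mu> x t - \<mu> * cos t" "slow b e \<mu> y t - \<mu> * cos t"]
      by (auto simp: abs_mult simp flip: right_diff_distrib intro!: mult_left_mono)
    ultimately have "\<bar>slow b e \<mu> x (2 * pi) - slow b e \<mu> y (2 * pi)\<bar> \<le>
        \<bar>slow b e \<mu> x 0 - slow b e \<mu> y 0\<bar> * exp (\<bar>e\<bar> * \<bar>2 * pi\<bar>)"
      by (rule linear_gronwall)
    then show "dist (slow_displacement b e \<mu> x) (slow_displacement b e \<mu> y) \<le> (exp (\<bar>e\<bar> * (2 * pi)) + 1) * dist x y"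
      by (auto simp: slow_displacement_eq dist_real_def algebra_simps)
  qed auto
  then show ?thesis by (rule lipschitz_on_continuous_on)
qed

lemma continuous_on_avg: "continuous_on S (avg b \<mu>)"
proof -
  have "continuous_on S (\<lambda>y. integral (cbox 0 (2 * pi)) (\<lambda>t. pwl (b - 1) b (y - \<mu> * cos t)))"
    by (rule integral_continuous_on_param) (auto simp: case_prod_unfold intro!: continuous_intros)
  then show ?thesis by (simp add: avg_def[abs_def])
qed

text \<open>On a compact set without zeros, \<open>\<bar>avg b \<mu> y\<bar>\<close> has a positive
  minimum \<kappa>, and the error of order \<open>e\<^sup>2\<close> is smaller than
  \<open>\<bar>e\<bar> * \<kappa>\<close> for all small \<open>e\<close> at once. The product form
  treats both signs of \<open>e\<close> together.\<close>

lemma slow_displacement_sign: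
  assumes b: "0 < b" "b < 1" and K: "compact K" and nz: "\<And>y. y \<in> K \<Longrightarrow> avg b \<mu> y \<noteq> 0"
  shows "\<forall>\<^sub>F e in at 0. \<forall>y\<in>K. e * slow_displacement b e \<mu> y * avg b \<mu> y > 0"
proof (cases "K = {}")
  case False
  have "continuous_on K (\<lambda>y. \<bar>avg b \<mu> y\<bar>)" by (intro continuous_intros continuous_on_avg)
  with K False obtain y0 where y0: "y0 \<in> K" and min: "\<And>y. y \<in> K \<Longrightarrow> \<bar>avg b \<mu> y0\<bar> \<le> \<bar>avg b \<mu> y\<bar>"
    using continuous_attains_inf[of K] by metis
  define \<kappa> where "\<kappa> = \<bar>avg b \<mu> y0\<bar>"
  have \<kappa>: "\<kappa> > 0" using nz[OF y0] by (simp add: \<kappa>_def)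
  obtain R where R: "\<And>y. y \<in> K \<Longrightarrow> \<bar>y\<bar> \<le> R"
    using compact_imp_bounded[OF K] by (auto simp: bounded_real)
  have "((\<lambda>e. 4 * pi * \<bar>e\<bar>) \<longlongrightarrow> 4 * pi * \<bar>0\<bar>) (at 0)" by (intro tendsto_intros)
  then have "\<forall>\<^sub>F e in at 0. 4 * pi * \<bar>e\<bar> < 1" by (rule order_tendstoD) simp
  moreover have "((\<lambda>e. 8 * pi\<^sup>2 * \<bar>e\<bar> * (R + \<bar>\<mu>\<bar>)) \<longlongrightarrow> 8 * pi\<^sup>2 * \<bar>0\<bar> * (R + \<bar>\<mu>\<bar>)) (at 0)"
    by (intro tendsto_intros)
  then have "\<forall>\<^sub>F e in at 0. 8 * pi\<^sup>2 * \<bar>e\<bar> * (R + \<bar>\<mu>\<bar>) < \<kappa>"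
    by (rule order_tendstoD) (use \<kappa> in simp)
  moreover have "\<forall>\<^sub>F e in at (0::real). e \<noteq> 0" by (simp add: eventually_at_filter)
  ultimately show ?thesis
  proof eventually_elim
    case (elim e)
    show ?case
    proof
      fix y assume y: "y \<in> K"
      define A where "A = avg b \<mu> y"
      define D where "D = slow_displacement b e \<mu> y"
      have "\<bar>e\<bar> * \<bar>D - e * A\<bar> \<le> \<bar>e\<bar> * (8 * pi\<^sup>2 * e\<^sup>2 * (\<bar>y\<bar> + \<bar>\<mu>\<bar>))"
        using slow_displacement_approx[OF b, of e \<mu> y] elim unfolding A_def D_def
        by (intro mult_left_mono) auto
      also have "\<dots> \<le> \<bar>e\<bar> * (8 * pi\<^sup>2 * e\<^sup>2 * (R + \<bar>\<mu>\<bar>))"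
        using R[OF y] by (intro mult_left_mono add_mono) auto
      also have "\<dots> = e\<^sup>2 * (8 * pi\<^sup>2 * \<bar>e\<bar> * (R + \<bar>\<mu>\<bar>))" by simp
      also have "\<dots> < e\<^sup>2 * \<kappa>" using elim by (intro mult_strict_left_mono) auto
      also have "\<dots> \<le> e\<^sup>2 * \<bar>A\<bar>" using min[OF y] by (intro mult_left_mono) (auto simp: \<kappa>_def A_def)
      finally have lt: "\<bar>e * D - e\<^sup>2 * A\<bar> < e\<^sup>2 * \<bar>A\<bar>"
        by (simp add: abs_mult[symmetric] algebra_simps power2_eq_square)
      have "A \<noteq> 0" using nz[OF y] by (simp add: A_def)
      then show "e * D * A > 0"
      proof (cases "A > 0")
        case True
        then have "e * D > 0" using lt by (simp add: abs_less_iff)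
        then show ?thesis using True by simp
      next
        case False
        then have "e * D < 0" using lt by (simp add: abs_less_iff)
        then show ?thesis using False \<open>A \<noteq> 0\<close> by (simp add: mult_neg_neg)
      qed
    qed
  qed
qed auto

text \<open>Compactness gives nothing for unbounded \<open>y\<close>. There, a zero of the
  displacement would force \<open>pwl\<close> to vanish at some time of the orbit, but the orbit
  stays too far from all zeros of \<open>pwl\<close>.\<close>

lemma slow_displacement_nonzero_outside:
  assumes b: "0 < b" "b < 1"
  shows "\<exists>R. \<forall>\<^sub>F e in at 0. \<forall>y. R \<le> \<bar>y\<bar> \<longrightarrow> slow_displacement b e \<mu> y \<noteq> 0"
proof (rule exI[of _ "2 / (1 - b) + 4 * \<bar>\<mu>\<bar> + 1"])
  have "((\<lambda>e. 8 * pi * \<bar>e\<bar>) \<longlongrightarrow> 8 * pi * \<bar>0\<bar>) (at 0)" by (intro tendsto_intros)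
  then have "\<forall>\<^sub>F e in at 0. 8 * pi * \<bar>e\<bar> < 1" by (rule order_tendstoD) simp
  moreover have "\<forall>\<^sub>F e in at (0::real). e \<noteq> 0" by (simp add: eventually_at_filter)
  ultimately show "\<forall>\<^sub>F e in at 0. \<forall>y. 2 / (1 - b) + 4 * \<bar>\<mu>\<bar> + 1 \<le> \<bar>y\<bar> \<longrightarrow> slow_displacement b e \<mu> y \<noteq> 0"
  proof eventually_elim
    case (elim e)
    show ?case
    proof (intro allI impI notI)
      fix y assume y: "2 / (1 - b) + 4 * \<bar>\<mu>\<bar> + 1 \<le> \<bar>y\<bar>" and 0: "slow_displacement b e \<mu> y = 0"
      from MVT2[OF _ has_derivative_slow, of 0 "2 * pi" b e \<mu> y] 0 elim
      obtain t where t: "0 < t" "t < 2 * pi" and f0: "pwl (b - 1) b (slow b e \<mu> y t - \<mu> * cos t) = 0"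
        by (auto simp: slow_displacement_eq)
      define x where "x = slow b e \<mu> y t - \<mu> * cos t"
      have "\<bar>slow b e \<mu> y t - y\<bar> \<le> 4 * pi * \<bar>e\<bar> * (\<bar>y\<bar> + \<bar>\<mu>\<bar>)"
        using t elim by (intro slow_close b) auto
      also have "\<dots> \<le> 1 / 2 * (\<bar>y\<bar> + \<bar>\<mu>\<bar>)"
        using elim by (intro mult_right_mono) auto
      finally have "\<bar>slow b e \<mu> y t - y\<bar> \<le> 1 / 2 * (\<bar>y\<bar> + \<bar>\<mu>\<bar>)" .
      moreover have "\<bar>\<mu> * cos t\<bar> \<le> \<bar>\<mu>\<bar>" by (simp add: abs_mult mult_left_le)
      moreover have "\<bar>y\<bar> \<le> \<bar>slow b e \<mu> y t - y\<bar> + \<bar>x\<bar> + \<bar>\<mu> * cos t\<bar>"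
        unfolding x_def by arith
      ultimately have "\<bar>y\<bar> / 2 - 3 / 2 * \<bar>\<mu>\<bar> \<le> \<bar>x\<bar>" by simp
      \<comment> \<open>The bound on \<open>\<bar>y\<bar>\<close> is chosen so that half of it still
        exceeds \<open>1 / (1 - b) + 3 / 2 * \<bar>\<mu>\<bar>\<close>; the zeros of
        \<open>pwl\<close> are 0 and the two points of modulus \<open>1 / (1 - b)\<close>.\<close>
      with y have "1 / (1 - b) < \<bar>x\<bar>" by simp
      then have "1 < (1 - b) * \<bar>x\<bar>" using b by (simp add: field_simps)
      moreover have "(1 - b) * \<bar>x\<bar> \<le> \<bar>x\<bar>" using b by (simp add: mult_left_le_one_le)
      ultimately show False
        using f0 unfolding x_def[symmetric] by (auto simp: pwl_def algebra_simps split: if_splits)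
    qed
  qed
qed

text \<open>A continuous minorant \<open>r\<close> of \<sigma> times the difference quotient, with
  positive integral, replaces the derivative of the flow in the initial value, so no
  differentiability of \<open>pwl\<close> is needed.\<close>

lemma slow_displacement_mono:
  assumes b: "0 < b" "b < 1" and e: "e \<noteq> 0" and \<sigma>: "\<sigma> = 1 \<or> \<sigma> = -1" and y: "y1 < y2"
    and r: "continuous_on {0..2 * pi} r" "0 < integral {0..2 * pi} r"
    and le: "\<And>t. t \<in> {0..2 * pi} \<Longrightarrow> slow b e \<mu> y1 t < slow b e \<mu> y2 t \<Longrightarrow>
      r t * (slow b e \<mu> y2 t - slow b e \<mu> y1 t) \<le>
      \<sigma> * (pwl (b - 1) b (slow b e \<mu> y2 t - \<mu> * cos t) - pwl (b - 1) b (slow b e \<mu> y1 t - \<mu> * cos t))"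
  shows "0 < \<sigma> * e * (slow_displacement b e \<mu> y2 - slow_displacement b e \<mu> y1)"
proof -
  define W where "W t = slow b e \<mu> y2 t - slow b e \<mu> y1 t" for t
  define F where "F t = pwl (b - 1) b (slow b e \<mu> y2 t - \<mu> * cos t) - pwl (b - 1) b (slow b e \<mu> y1 t - \<mu> * cos t)" for t
  have W': "(W has_real_derivative e * F t) (at t)" for t
    unfolding W_def[abs_def] F_def
    by (auto intro!: derivative_eq_intros has_derivative_slow simp: algebra_simps)
  \<comment> \<open>If \<open>W\<close> vanished at some time, the two solutions would coincide,
    contradicting \<open>y1 < y2\<close>; hence \<open>ln W\<close> is defined.\<close>
  have Wpos: "W t > 0" if "t \<ge> 0" for t
  proof (rule ccontr)
    assume "\<not> W t > 0"
    moreover have "W 0 \<ge> 0" using y by (simp add: W_def)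
    moreover have "continuous_on {0..t} W"
      by (intro continuous_at_imp_continuous_on ballI DERIV_isCont[OF W'])
    ultimately have "\<exists>s\<ge>0. s \<le> t \<and> W s = 0" using that by (intro IVT2') auto
    then obtain s where "W s = 0" by blast
    then have "sol (b - 1) b e \<mu> s (y2 - \<mu>) = sol (b - 1) b e \<mu> s (y1 - \<mu>)"
      by (simp add: W_def slow_def)
    then have "(\<lambda>t. sol (b - 1) b e \<mu> t (y2 - \<mu>)) = (\<lambda>t. sol (b - 1) b e \<mu> t (y1 - \<mu>))"
      by (rule is_solution_unique[OF is_solution_sol is_solution_sol])
    then have "y2 - \<mu> = y1 - \<mu>" by (metis sol_0)
    with y show False by simp
  qed
  \<comment> \<open>Multiplying the logarithm by \<open>\<sigma> * e\<close> produces the factor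
    \<open>e\<^sup>2\<close> in the integrand, so the comparison with \<open>r\<close> does not
    depend on the sign of \<open>e\<close>.\<close>
  have "((\<lambda>t. \<sigma> * e * (e * F t / W t)) has_integral \<sigma> * e * ln (W (2 * pi)) - \<sigma> * e * ln (W 0)) {0..2 * pi}"
  proof (rule fundamental_theorem_of_calculus)
    fix t assume "t \<in> {0..2 * pi}"
    then have "((\<lambda>t. \<sigma> * e * ln (W t)) has_real_derivative \<sigma> * e * (e * F t / W t)) (at t)"
      using Wpos[of t] by (auto intro!: derivative_eq_intros W')
    then show "((\<lambda>t. \<sigma> * e * ln (W t)) has_vector_derivative \<sigma> * e * (e * F t / W t)) (at t within {0..2 * pi})"
      by (auto simp flip: has_real_derivative_iff_has_vector_derivative intro: DERIV_subset)
  qed simp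
  note int = this
  have "((\<lambda>t. e\<^sup>2 * r t) has_integral e\<^sup>2 * integral {0..2 * pi} r) {0..2 * pi}"
    by (intro has_integral_mult_right integrable_integral integrable_continuous_interval r)
  then have "e\<^sup>2 * integral {0..2 * pi} r \<le> \<sigma> * e * ln (W (2 * pi)) - \<sigma> * e * ln (W 0)"
  proof (rule has_integral_le[OF _ int])
    fix t assume t: "t \<in> {0..2 * pi}"
    then have pos: "W t > 0" using Wpos by simp
    have "r t * W t \<le> \<sigma> * F t" using le[OF t] pos by (simp add: W_def F_def)
    then have "r t \<le> \<sigma> * F t / W t" using pos by (simp add: field_simps)
    then have "e\<^sup>2 * r t \<le> e\<^sup>2 * (\<sigma> * F t / W t)" by (intro mult_left_mono) auto
    then show "e\<^sup>2 * r t \<le> \<sigma> * e * (e * F t / W t)" by (simp add: power2_eq_square algebra_simps)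
  qed
  moreover have "e\<^sup>2 * integral {0..2 * pi} r > 0" using e r by simp
  ultimately have *: "0 < (\<sigma> * e) * (ln (W (2 * pi)) - ln (W 0))" by (simp add: algebra_simps)
  have pos: "W (2 * pi) > 0" "W 0 > 0" using Wpos by auto
  have "0 < (\<sigma> * e) * (W (2 * pi) - W 0)"
    using * pos unfolding zero_less_mult_iff by auto
  moreover have "W (2 * pi) - W 0 = slow_displacement b e \<mu> y2 - slow_displacement b e \<mu> y1"
    by (simp add: W_def slow_displacement_eq)
  ultimately show ?thesis by simp
qed

subsection \<open>Slopes of the displacement function\<close>

text \<open>Only the upper ramp of \<open>pwl\<close> is integrated; the lower ramp gives the same
  function at \<open>- y\<close>, because replacing \<open>cos\<close> by its negative does not
  change the integral.\<close>

definition ramp_integral :: "real \<Rightarrow> real \<Rightarrow> real" where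
  "ramp_integral \<mu> y = integral {0..2 * pi} (\<lambda>t. max 0 (y - 1 - \<mu> * cos t))"

lemma ramp_integrable: "(\<lambda>t. max 0 (y - 1 - \<mu> * cos t)) integrable_on {c..d}" for y :: real
  by (intro integrable_continuous_interval continuous_intros)

lemma has_integral_ramp:
  "((\<lambda>t. max 0 (y - 1 - \<mu> * cos t)) has_integral ramp_integral \<mu> y) {0..2 * pi}"
  unfolding ramp_integral_def by (intro integrable_integral ramp_integrable)

lemma integral_cos_reflect:
  fixes h :: "real \<Rightarrow> real"
  assumes h: "continuous_on UNIV h"
  shows "integral {0..pi} (\<lambda>t. h (- cos t)) = integral {0..pi} (\<lambda>t. h (cos t))"
proof -
  have "(\<lambda>t. h (cos t)) integrable_on {0..pi}"
    by (intro integrable_continuous_interval continuous_on_compose2[OF h] continuous_intros) auto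
  then have "((\<lambda>t. h (cos t)) has_integral integral {0..pi} (\<lambda>t. h (cos t))) (cbox 0 pi)"
    by (simp add: integrable_integral)
  from has_integral_affinity[OF this, of "-1" pi]
  have "((\<lambda>t. h (cos (- t + pi))) has_integral integral {0..pi} (\<lambda>t. h (cos t))) ((\<lambda>x. - x + pi) ` {0..pi})"
    by simp
  moreover have "(\<lambda>x. - x + pi) ` {0..pi} = {0..pi}"
    by (auto simp: image_iff intro!: bexI[of _ "pi - _"])
  ultimately show ?thesis by (simp add: integral_unique)
qed

text \<open>Shifting the second half period by \<open>pi\<close> changes the sign of
  \<open>cos\<close>, and the reflection \<open>t\<close> to \<open>pi - t\<close> changes it back.
  This confines the computations to the interval from 0 to \<open>pi\<close>, where
  \<open>cos\<close> is monotone.\<close>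

lemma integral_cos_period:
  fixes h :: "real \<Rightarrow> real"
  assumes h: "continuous_on UNIV h"
  shows "integral {0..2 * pi} (\<lambda>t. h (cos t)) = 2 * integral {0..pi} (\<lambda>t. h (cos t))"
proof -
  have int: "(\<lambda>t. h (cos t)) integrable_on {c..d}" "(\<lambda>t. h (- cos t)) integrable_on {c..d}" for c d
    by (intro integrable_continuous_interval continuous_on_compose2[OF h] continuous_intros; auto)+
  have "((\<lambda>t. h (- cos t)) has_integral integral {0..pi} (\<lambda>t. h (- cos t))) (cbox 0 pi)"
    using int by (simp add: integrable_integral)
  from has_integral_affinity[OF this, of 1 "- pi"]
  have "((\<lambda>t. h (cos t)) has_integral integral {0..pi} (\<lambda>t. h (- cos t))) ((\<lambda>x. x + pi) ` {0..pi})"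
    by (simp add: cos_diff)
  moreover have "(\<lambda>x. x + pi) ` {0..pi} = {pi..2 * pi}" by simp
  ultimately have "integral {pi..2 * pi} (\<lambda>t. h (cos t)) = integral {0..pi} (\<lambda>t. h (- cos t))"
    by (simp add: integral_unique)
  then show ?thesis
    using Henstock_Kurzweil_Integration.integral_combine[of 0 pi "2 * pi" "\<lambda>t. h (cos t)"] int
    by (simp add: integral_cos_reflect[OF h])
qed

lemma ramp_integral_eq: "ramp_integral \<mu> y = 2 * integral {0..pi} (\<lambda>t. max 0 (y - 1 - \<mu> * cos t))"
  unfolding ramp_integral_def
  by (rule integral_cos_period[of "\<lambda>c. max 0 (y - 1 - \<mu> * c)"]) (intro continuous_intros)

lemma ramp_integral_minus [simp]: "ramp_integral (- \<mu>) y = ramp_integral \<mu> y"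
proof -
  have "integral {0..pi} (\<lambda>t. max 0 (y - 1 - \<mu> * - cos t)) = integral {0..pi} (\<lambda>t. max 0 (y - 1 - \<mu> * cos t))"
    by (rule integral_cos_reflect[of "\<lambda>c. max 0 (y - 1 - \<mu> * c)"]) (intro continuous_intros)
  then show ?thesis by (simp add: ramp_integral_eq)
qed

lemma has_integral_ramp_minus:
  "((\<lambda>t. max 0 (- y - 1 + \<mu> * cos t)) has_integral ramp_integral \<mu> (- y)) {0..2 * pi}"
  using has_integral_ramp[of "- y" "- \<mu>"] by simp

lemma avg_eq: "avg b \<mu> y = 2 * pi * b * y - ramp_integral \<mu> y + ramp_integral \<mu> (- y)"
proof -
  have c: "((\<lambda>t. b * (y - \<mu> * cos t)) has_integral
      (b * (y * (2 * pi) - \<mu> * sin (2 * pi)) - b * (y * 0 - \<mu> * sin 0))) {0..2 * pi}"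
    by (rule fundamental_theorem_of_calculus)
      (auto intro!: derivative_eq_intros simp flip: has_real_derivative_iff_has_vector_derivative)
  have "((\<lambda>t. b * (y - \<mu> * cos t) - max 0 (y - 1 - \<mu> * cos t) + max 0 (- y - 1 + \<mu> * cos t))
      has_integral b * (y * (2 * pi)) - ramp_integral \<mu> y + ramp_integral \<mu> (- y)) {0..2 * pi}"
    using c by (intro has_integral_add has_integral_diff has_integral_ramp has_integral_ramp_minus) simp
  moreover have "pwl (b - 1) b (y - \<mu> * cos t) =
      b * (y - \<mu> * cos t) - max 0 (y - 1 - \<mu> * cos t) + max 0 (- y - 1 + \<mu> * cos t)" for t
    by (simp add: pwl_eq algebra_simps)
  ultimately show ?thesis by (simp add: avg_def integral_unique)
qed

lemma avg_minus: "avg b \<mu> (- y) = - avg b \<mu> y"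
  by (simp add: avg_eq)

text \<open>Convexity of \<open>max 0\<close>: secant slopes left of \<open>w\<close> do not exceed
  the one just right of \<open>w\<close>. The multiplied form also covers
  \<open>v1 = v2\<close>.\<close>

lemma ramp_slope_le:
  fixes v1 v2 w \<delta> :: real
  assumes "v1 \<le> v2" "v2 \<le> w" "\<delta> > 0"
  shows "max 0 v2 - max 0 v1 \<le> (max 0 (w + \<delta>) - max 0 w) / \<delta> * (v2 - v1)"
proof (cases "w \<le> 0")
  case True
  then show ?thesis using assms by simp
next
  case False
  then show ?thesis using assms by (simp add: max_def)
qed

lemma ramp_slope_ge:
  fixes v1 v2 w \<delta> :: real
  assumes "v1 \<le> v2" "w \<le> v1" "\<delta> > 0"
  shows "(max 0 w - max 0 (w - \<delta>)) / \<delta> * (v2 - v1) \<le> max 0 v2 - max 0 v1"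
proof (cases "w \<le> 0")
  case True
  then show ?thesis using assms by simp
next
  case False
  have "(max 0 w - max 0 (w - \<delta>)) / \<delta> \<le> 1" using False assms by (simp add: max_def)
  then have "(max 0 w - max 0 (w - \<delta>)) / \<delta> * (v2 - v1) \<le> 1 * (v2 - v1)"
    using assms by (intro mult_right_mono) auto
  then show ?thesis using assms False by simp
qed

text \<open>Both ends of the secant move with \<delta>, as the secants used below do not start at
  the base point; inserting \<open>f x\<close> splits the quotient into two ordinary ones.\<close>

lemma DERIV_difference_quotient_at:
  fixes f :: "real \<Rightarrow> real"
  assumes "(f has_real_derivative D) (at x)"
  shows "((\<lambda>\<delta>. (f (x + r * \<delta>) - f (x + s * \<delta>)) / \<delta>) \<longlongrightarrow> (r - s) * D) (at_right 0)"
proof -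
  have *: "((\<lambda>\<delta>. (f (x + r * \<delta>) - f x) / \<delta>) \<longlongrightarrow> r * D) (at_right 0)" for r
  proof -
    have "((\<lambda>\<delta>. f (x + r * \<delta>)) has_real_derivative D * r) (at 0)"
      using assms by (auto intro!: derivative_eq_intros DERIV_chain2[of f])
    then have "((\<lambda>\<delta>. (f (x + r * \<delta>) - f x) / \<delta>) \<longlongrightarrow> D * r) (at 0)"
      by (simp add: has_field_derivative_iff)
    then show ?thesis by (simp add: mult.commute filterlim_at_split)
  qed
  show ?thesis
    using tendsto_diff[OF *[of r] *[of s]]
    by (simp add: algebra_simps flip: diff_divide_distrib)
qed

text \<open>The window \<eta> is fixed before \<open>e\<close>, so zeros can be counted in windows
  that do not shrink with \<open>e\<close>.\<close>

lemma slow_displacement_locally_mono: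
  assumes b: "0 < b" "b < 1" and \<sigma>: "\<sigma> = 1 \<or> \<sigma> = -1"
    and p: "(ramp_integral \<mu> has_real_derivative p) (at z)"
    and q: "(ramp_integral \<mu> has_real_derivative q) (at (- z))"
    and pos: "\<sigma> * (2 * pi * b - p - q) > 0"
  shows "\<exists>\<eta>>0. \<forall>\<^sub>F e in at 0. \<forall>y1 y2. \<bar>y1 - z\<bar> \<le> \<eta> \<longrightarrow> \<bar>y2 - z\<bar> \<le> \<eta> \<longrightarrow> y1 < y2 \<longrightarrow>
     0 < \<sigma> * e * (slow_displacement b e \<mu> y2 - slow_displacement b e \<mu> y1)"
proof -
  \<comment> \<open>By convexity of the ramps, difference quotients of \<open>f\<close> between points within \<open>\<delta>\<close> of \<open>u\<close>
    are bounded below (\<open>\<sigma> = 1\<close>) by slopes of the ramps between \<open>u + \<delta>\<close> and \<open>u + 2\<delta>\<close>, and above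
    (\<open>\<sigma> = -1\<close>) by slopes between \<open>u - 2\<delta>\<close> and \<open>u - \<delta>\<close>.\<close>
  define m n where "m = (3 * \<sigma> + 1) / 2" and "n = (3 * \<sigma> - 1) / 2"
  have mn: "m - n = 1" by (simp add: m_def n_def field_simps)
  \<comment> \<open>The pair \<open>m\<close>, \<open>n\<close> is 2, 1 for
    \<open>\<sigma> = 1\<close> and -1, -2 for \<open>\<sigma> = -1\<close>.
    \<open>I \<delta>\<close> is the period integral of the minorant \<open>r\<close> defined below;
    its limit as \<delta> tends to 0 is positive by \<open>pos\<close>, so one suitable \<delta> can
    be fixed.\<close>
  define I where "I \<delta> = \<sigma> * (2 * pi * b) -
    \<sigma> * ((ramp_integral \<mu> (z + m * \<delta>) - ramp_integral \<mu> (z + n * \<delta>)) / \<delta>) -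
    \<sigma> * ((ramp_integral \<mu> (- z + m * \<delta>) - ramp_integral \<mu> (- z + n * \<delta>)) / \<delta>)" for \<delta>
  have "(I \<longlongrightarrow> \<sigma> * (2 * pi * b) - \<sigma> * p - \<sigma> * q) (at_right 0)"
    using DERIV_difference_quotient_at[OF p, of m n] DERIV_difference_quotient_at[OF q, of m n]
    unfolding I_def by (intro tendsto_intros) (simp_all add: mn)
  moreover have "0 < \<sigma> * (2 * pi * b) - \<sigma> * p - \<sigma> * q" using pos by (simp add: algebra_simps)
  ultimately have "\<forall>\<^sub>F \<delta> in at_right 0. I \<delta> > 0" by (rule order_tendstoD)
  moreover have "\<forall>\<^sub>F \<delta> in at_right (0::real). \<delta> > 0" by (rule eventually_at_right_less)
  ultimately have "\<forall>\<^sub>F \<delta> in at_right 0. I \<delta> > 0 \<and> \<delta> > 0" by (rule eventually_conj)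
  then obtain \<delta> where I: "I \<delta> > 0" and \<delta>: "\<delta> > 0"
    using eventually_happens'[OF trivial_limit_at_right_real] by blast
  define r where "r t = \<sigma> * b -
    \<sigma> * ((max 0 (z + m * \<delta> - 1 - \<mu> * cos t) - max 0 (z + n * \<delta> - 1 - \<mu> * cos t)) / \<delta>) -
    \<sigma> * ((max 0 (- (z - m * \<delta>) - 1 + \<mu> * cos t) - max 0 (- (z - n * \<delta>) - 1 + \<mu> * cos t)) / \<delta>)" for t
  have rcont: "continuous_on {0..2 * pi} r" using \<delta> unfolding r_def by (intro continuous_intros) auto
  have "((\<lambda>t. b) has_integral 2 * pi * b) {0..2 * pi}"
    using has_integral_const_real[of b 0 "2 * pi"] by simp
  then have "(r has_integral I \<delta>) {0..2 * pi}"
    using has_integral_ramp_minus[of "z - m * \<delta>" \<mu>] has_integral_ramp_minus[of "z - n * \<delta>" \<mu>]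
    unfolding r_def[abs_def] I_def
    by (intro has_integral_diff has_integral_mult_right has_integral_divide has_integral_ramp) auto
  with I have rpos: "0 < integral {0..2 * pi} r" by (simp add: integral_unique)
  show ?thesis
  \<comment> \<open>Half of \<delta> is kept for the drift during one period, so orbits starting in
    the window stay within \<delta> of \<open>z\<close>.\<close>
  proof (intro exI[of _ "\<delta> / 2"] conjI)
    have "((\<lambda>e. 4 * pi * \<bar>e\<bar>) \<longlongrightarrow> 4 * pi * \<bar>0\<bar>) (at 0)" by (intro tendsto_intros)
    then have "\<forall>\<^sub>F e in at 0. 4 * pi * \<bar>e\<bar> < 1" by (rule order_tendstoD) simp
    moreover have "((\<lambda>e. 4 * pi * \<bar>e\<bar> * (\<bar>z\<bar> + \<delta> / 2 + \<bar>\<mu>\<bar>)) \<longlongrightarrow> 4 * pi * \<bar>0\<bar> * (\<bar>z\<bar> + \<delta> / 2 + \<bar>\<mu>\<bar>)) (at 0)"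
      by (intro tendsto_intros)
    then have "\<forall>\<^sub>F e in at 0. 4 * pi * \<bar>e\<bar> * (\<bar>z\<bar> + \<delta> / 2 + \<bar>\<mu>\<bar>) < \<delta> / 2"
      by (rule order_tendstoD) (use \<delta> in simp)
    moreover have "\<forall>\<^sub>F e in at (0::real). e \<noteq> 0" by (simp add: eventually_at_filter)
    ultimately show "\<forall>\<^sub>F e in at 0. \<forall>y1 y2. \<bar>y1 - z\<bar> \<le> \<delta> / 2 \<longrightarrow> \<bar>y2 - z\<bar> \<le> \<delta> / 2 \<longrightarrow> y1 < y2 \<longrightarrow>
        0 < \<sigma> * e * (slow_displacement b e \<mu> y2 - slow_displacement b e \<mu> y1)"
    proof eventually_elim
      case (elim e)
      have near: "\<bar>slow b e \<mu> y t - z\<bar> \<le> \<delta>" if y: "\<bar>y - z\<bar> \<le> \<delta> / 2" and t: "t \<in> {0..2 * pi}" for y t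
      proof -
        have "\<bar>slow b e \<mu> y t - y\<bar> \<le> 4 * pi * \<bar>e\<bar> * (\<bar>y\<bar> + \<bar>\<mu>\<bar>)"
          using elim t by (intro slow_close b) auto
        also have "\<dots> \<le> 4 * pi * \<bar>e\<bar> * (\<bar>z\<bar> + \<delta> / 2 + \<bar>\<mu>\<bar>)"
          using y abs_triangle_ineq[of "y - z" z] by (intro mult_left_mono) auto
        finally show ?thesis using elim y by linarith
      qed
      show ?case
      proof (intro allI impI)
        fix y1 y2 assume y: "\<bar>y1 - z\<bar> \<le> \<delta> / 2" "\<bar>y2 - z\<bar> \<le> \<delta> / 2" "y1 < y2"
        show "0 < \<sigma> * e * (slow_displacement b e \<mu> y2 - slow_displacement b e \<mu> y1)"
        proof (rule slow_displacement_mono[OF b _ \<sigma> y(3) rcont rpos])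
          show "e \<noteq> 0" using elim by simp
          fix t assume t: "t \<in> {0..2 * pi}" and lt: "slow b e \<mu> y1 t < slow b e \<mu> y2 t"
          define v1 v2 where "v1 = slow b e \<mu> y1 t - \<mu> * cos t" and "v2 = slow b e \<mu> y2 t - \<mu> * cos t"
          define u where "u = z - \<mu> * cos t"
          have v: "v1 < v2" "u - \<delta> \<le> v1" "v2 \<le> u + \<delta>"
            using lt near[OF y(1) t] near[OF y(2) t] by (auto simp: v1_def v2_def u_def)
          have f: "pwl (b - 1) b v2 - pwl (b - 1) b v1 = b * (v2 - v1) -
              (max 0 (v2 - 1) - max 0 (v1 - 1)) - (max 0 (- v1 - 1) - max 0 (- v2 - 1))"
            by (simp add: pwl_eq algebra_simps)
          have "r t * (v2 - v1) \<le> \<sigma> * (pwl (b - 1) b v2 - pwl (b - 1) b v1)"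
            using \<sigma>
          proof
            assume s: "\<sigma> = 1"
            have "r t = b - (max 0 (u + \<delta> - 1 + \<delta>) - max 0 (u + \<delta> - 1)) / \<delta>
                - (max 0 (- u + \<delta> - 1 + \<delta>) - max 0 (- u + \<delta> - 1)) / \<delta>"
              by (simp add: r_def u_def s m_def n_def algebra_simps diff_divide_distrib)
            moreover have "max 0 (v2 - 1) - max 0 (v1 - 1) \<le>
                (max 0 (u + \<delta> - 1 + \<delta>) - max 0 (u + \<delta> - 1)) / \<delta> * ((v2 - 1) - (v1 - 1))"
              using v \<delta> by (intro ramp_slope_le) auto
            moreover have "max 0 (- v1 - 1) - max 0 (- v2 - 1) \<le>
                (max 0 (- u + \<delta> - 1 + \<delta>) - max 0 (- u + \<delta> - 1)) / \<delta> * ((- v1 - 1) - (- v2 - 1))"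
              using v \<delta> by (intro ramp_slope_le) auto
            ultimately show ?thesis unfolding f s by (simp add: left_diff_distrib)
          next
            assume s: "\<sigma> = -1"
            have "r t = - b + (max 0 (u - \<delta> - 1) - max 0 (u - \<delta> - 1 - \<delta>)) / \<delta>
                + (max 0 (- u - \<delta> - 1) - max 0 (- u - \<delta> - 1 - \<delta>)) / \<delta>"
              by (simp add: r_def u_def s m_def n_def algebra_simps diff_divide_distrib)
            moreover have "max 0 (v2 - 1) - max 0 (v1 - 1) \<ge>
                (max 0 (u - \<delta> - 1) - max 0 (u - \<delta> - 1 - \<delta>)) / \<delta> * ((v2 - 1) - (v1 - 1))"
              using v \<delta> by (intro ramp_slope_ge) auto
            moreover have "max 0 (- v1 - 1) - max 0 (- v2 - 1) \<ge>
                (max 0 (- u - \<delta> - 1) - max 0 (- u - \<delta> - 1 - \<delta>)) / \<delta> * ((- v1 - 1) - (- v2 - 1))"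
              using v \<delta> by (intro ramp_slope_ge) auto
            ultimately show ?thesis unfolding f s by (simp add: distrib_right left_diff_distrib)
          qed
          then show "r t * (slow b e \<mu> y2 t - slow b e \<mu> y1 t) \<le>
              \<sigma> * (pwl (b - 1) b (slow b e \<mu> y2 t - \<mu> * cos t) - pwl (b - 1) b (slow b e \<mu> y1 t - \<mu> * cos t))"
            by (simp add: v1_def v2_def)
        qed
      qed
    qed
  qed (use \<delta> in simp)
qed

subsection \<open>Counting zeros\<close>

text \<open>Small windows around the points of \<open>Z\<close> each contain exactly one zero:
  existence by the intermediate value theorem, uniqueness by local monotonicity. Elsewhere the sign
  of \<open>avg\<close> excludes zeros on a compact set, and the bound for large
  \<open>\<bar>y\<bar>\<close> handles the rest.\<close>

lemma card_zeros_slow_displacement: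
  assumes b: "0 < b" "b < 1" and Z: "finite Z" "\<And>y. avg b \<mu> y = 0 \<longleftrightarrow> y \<in> Z"
    and simple: "\<forall>z\<in>Z. \<exists>p q. (ramp_integral \<mu> has_real_derivative p) (at z) \<and>
      (ramp_integral \<mu> has_real_derivative q) (at (- z)) \<and> 2 * pi * b - p - q \<noteq> 0"
  shows "\<forall>\<^sub>F e in at 0. finite {y. slow_displacement b e \<mu> y = 0} \<and>
    card {y. slow_displacement b e \<mu> y = 0} = card Z"
proof -
  define sign_change where "sign_change z \<sigma> \<longleftrightarrow>
      (\<forall>\<^sub>F h in at_right 0. 0 < \<sigma> * avg b \<mu> (z + h) \<and> \<sigma> * avg b \<mu> (z - h) < 0)" for z \<sigma>
  define local_mono where "local_mono z \<sigma> \<eta> \<longleftrightarrow>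
      (\<forall>\<^sub>F e in at 0. \<forall>y1 y2. \<bar>y1 - z\<bar> \<le> \<eta> \<longrightarrow> \<bar>y2 - z\<bar> \<le> \<eta> \<longrightarrow> y1 < y2 \<longrightarrow>
        0 < \<sigma> * e * (slow_displacement b e \<mu> y2 - slow_displacement b e \<mu> y1))" for z \<sigma> \<eta>
  have "\<exists>\<sigma> \<eta>. (\<sigma> = 1 \<or> \<sigma> = -1) \<and> \<eta> > 0 \<and> sign_change z \<sigma> \<and> local_mono z \<sigma> \<eta>"
    if z: "z \<in> Z" for z
  proof -
    obtain p q where p: "(ramp_integral \<mu> has_real_derivative p) (at z)"
      and q: "(ramp_integral \<mu> has_real_derivative q) (at (- z))" and nz: "2 * pi * b - p - q \<noteq> 0"
      using simple z by blast
    define \<sigma> where "\<sigma> = sgn (2 * pi * b - p - q)"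
    have \<sigma>: "\<sigma> = 1 \<or> \<sigma> = -1" using nz by (auto simp: \<sigma>_def sgn_if)
    have pos: "\<sigma> * (2 * pi * b - p - q) > 0" using nz by (simp add: \<sigma>_def sgn_if)
    have "(avg b \<mu> has_real_derivative 2 * pi * b - p - q) (at z)"
      unfolding avg_eq[abs_def] using q
      by (auto intro!: derivative_eq_intros p DERIV_chain2[of "ramp_integral \<mu>"])
    then have d: "((\<lambda>y. \<sigma> * avg b \<mu> y) has_real_derivative \<sigma> * (2 * pi * b - p - q)) (at z)"
      by (rule DERIV_cmult)
    have 0: "avg b \<mu> z = 0" using Z z by simp
    have "\<forall>\<^sub>F h in at_right 0. 0 < \<sigma> * avg b \<mu> (z + h)"
      using DERIV_pos_inc_right[OF d pos] 0 by (auto simp: eventually_at_right_field)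
    moreover have "\<forall>\<^sub>F h in at_right 0. \<sigma> * avg b \<mu> (z - h) < 0"
      using DERIV_pos_inc_left[OF d pos] 0 by (auto simp: eventually_at_right_field)
    ultimately have "sign_change z \<sigma>"
      unfolding sign_change_def by (rule eventually_conj)
    moreover obtain \<eta> where "\<eta> > 0" "local_mono z \<sigma> \<eta>"
      using slow_displacement_locally_mono[OF b \<sigma> p q pos] unfolding local_mono_def by (elim exE conjE)
    ultimately show ?thesis using \<sigma> by metis
  qed
  then obtain \<sigma> \<eta>0 where \<sigma>: "\<And>z. z \<in> Z \<Longrightarrow> \<sigma> z = 1 \<or> \<sigma> z = -1" and \<eta>0: "\<And>z. z \<in> Z \<Longrightarrow> \<eta>0 z > 0"
    and sc: "\<And>z. z \<in> Z \<Longrightarrow> sign_change z (\<sigma> z)" and lm: "\<And>z. z \<in> Z \<Longrightarrow> local_mono z (\<sigma> z) (\<eta>0 z)"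
    by metis
  note ev_h = sc[unfolded sign_change_def] and ev_mono = lm[unfolded local_mono_def]
  have lt: "\<forall>\<^sub>F h in at_right 0. h < \<eta>" if "\<eta> > 0" for \<eta> :: real
    using that by (auto simp: eventually_at_right_field)
  have "\<forall>\<^sub>F h in at_right 0. \<forall>z\<in>Z. 0 < \<sigma> z * avg b \<mu> (z + h) \<and> \<sigma> z * avg b \<mu> (z - h) < 0"
    using Z ev_h by (simp add: eventually_ball_finite)
  moreover have "\<forall>\<^sub>F h in at_right 0. \<forall>z\<in>Z. h < \<eta>0 z"
    using Z \<eta>0 lt by (simp add: eventually_ball_finite)
  \<comment> \<open>A radius below half of every distance keeps the windows disjoint, which makes
    the assignment of zeros injective.\<close>
  moreover have "\<forall>\<^sub>F h in at_right 0. \<forall>z\<in>Z. \<forall>z'\<in>Z - {z}. h < \<bar>z - z'\<bar> / 2"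
    using Z by (intro eventually_ball_finite ballI lt) auto
  moreover have "\<forall>\<^sub>F h in at_right (0::real). h > 0" by (rule eventually_at_right_less)
  ultimately have "\<forall>\<^sub>F h in at_right 0. (\<forall>z\<in>Z. 0 < \<sigma> z * avg b \<mu> (z + h) \<and> \<sigma> z * avg b \<mu> (z - h) < 0) \<and>
      (\<forall>z\<in>Z. h < \<eta>0 z) \<and> (\<forall>z\<in>Z. \<forall>z'\<in>Z - {z}. h < \<bar>z - z'\<bar> / 2) \<and> h > 0"
    by (intro eventually_conj)
  from eventually_happens'[OF trivial_limit_at_right_real this]
  obtain h where h_sign: "\<forall>z\<in>Z. 0 < \<sigma> z * avg b \<mu> (z + h) \<and> \<sigma> z * avg b \<mu> (z - h) < 0"
    and h_le: "\<forall>z\<in>Z. h < \<eta>0 z" and sep: "\<forall>z\<in>Z. \<forall>z'\<in>Z - {z}. h < \<bar>z - z'\<bar> / 2" and h_pos: "h > 0"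
    by (elim exE conjE)
  obtain R where R: "\<forall>\<^sub>F e in at 0. \<forall>y. R \<le> \<bar>y\<bar> \<longrightarrow> slow_displacement b e \<mu> y \<noteq> 0"
    using slow_displacement_nonzero_outside[OF b] by blast
  \<comment> \<open>The end points of the windows are added explicitly: the sign of the displacement
    is needed there, and they need not lie between \<open>- R\<close> and \<open>R\<close>.\<close>
  define K where "K = ({- R..R} - (\<Union>z\<in>Z. ball z h)) \<union> ((\<lambda>z. z + h) ` Z \<union> (\<lambda>z. z - h) ` Z)"
  have "compact K"
    unfolding K_def by (intro compact_Un compact_diff compact_Icc open_UN finite_imp_compact finite_imageI Z) auto
  moreover have "avg b \<mu> y \<noteq> 0" if yK: "y \<in> K" for y
  proof
    assume "avg b \<mu> y = 0"
    then have "y \<in> Z" using Z(2) by blast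
    then have "y \<in> (\<Union>z\<in>Z. ball z h)" using h_pos by (intro UN_I) auto
    then obtain z where "z \<in> Z" "y = z + h \<or> y = z - h" using yK unfolding K_def by blast
    with h_sign \<open>avg b \<mu> y = 0\<close> show False by auto
  qed
  ultimately have "\<forall>\<^sub>F e in at 0. \<forall>y\<in>K. e * slow_displacement b e \<mu> y * avg b \<mu> y > 0"
    by (rule slow_displacement_sign[OF b])
  moreover have "\<forall>\<^sub>F e in at 0. \<forall>z\<in>Z. \<forall>y1 y2. \<bar>y1 - z\<bar> \<le> \<eta>0 z \<longrightarrow> \<bar>y2 - z\<bar> \<le> \<eta>0 z \<longrightarrow> y1 < y2 \<longrightarrow>
        0 < \<sigma> z * e * (slow_displacement b e \<mu> y2 - slow_displacement b e \<mu> y1)"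
    using Z ev_mono by (intro eventually_ball_finite ballI) auto
  moreover note R
  ultimately show ?thesis
  proof eventually_elim
    case (elim e)
    define D where "D = slow_displacement b e \<mu>"
    have sign: "e * D y * avg b \<mu> y > 0" if "y \<in> K" for y using elim(1) that by (auto simp: D_def)
    have mono: "0 < \<sigma> z * e * (D y2 - D y1)"
      if "z \<in> Z" "\<bar>y1 - z\<bar> \<le> h" "\<bar>y2 - z\<bar> \<le> h" "y1 < y2" for z y1 y2
    proof -
      have "h < \<eta>0 z" using h_le that(1) by blast
      then show ?thesis using that unfolding D_def by (intro elim(2)[rule_format]) auto
    qed
    have unique: "y1 = y2" if "z \<in> Z" "\<bar>y1 - z\<bar> \<le> h" "\<bar>y2 - z\<bar> \<le> h" "D y1 = 0" "D y2 = 0" for z y1 y2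
      using mono[of z y1 y2] mono[of z y2 y1] that by (cases y1 y2 rule: linorder_cases) auto
    have "\<exists>y. \<bar>y - z\<bar> \<le> h \<and> D y = 0" if z: "z \<in> Z" for z
    proof -
      have pos: "e * D (z + h) * avg b \<mu> (z + h) > 0" "e * D (z - h) * avg b \<mu> (z - h) > 0"
        using z by (auto intro!: sign simp: K_def)
      \<comment> \<open>Inserting the square of the sign turns the positivity on \<open>K\<close>
        into the statement that \<open>\<sigma> z * e * D\<close> has the sign of
        \<open>\<sigma> z * avg b \<mu>\<close> at both end points.\<close>
      have "\<sigma> z * \<sigma> z = 1" using \<sigma>[OF z] by auto
      then have "(\<sigma> z * e * D y) * (\<sigma> z * avg b \<mu> y) = e * D y * avg b \<mu> y" for y by algebra
      then have "(\<sigma> z * e * D (z + h)) * (\<sigma> z * avg b \<mu> (z + h)) > 0"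
        "(\<sigma> z * e * D (z - h)) * (\<sigma> z * avg b \<mu> (z - h)) > 0" using pos by (simp_all only:)
      moreover have "0 < \<sigma> z * avg b \<mu> (z + h)" "\<sigma> z * avg b \<mu> (z - h) < 0" using h_sign z by auto
      ultimately have "\<sigma> z * e * D (z - h) \<le> 0" "0 \<le> \<sigma> z * e * D (z + h)"
        by (metis less_imp_le not_less_iff_gr_or_eq zero_less_mult_iff)+
      moreover have "e \<noteq> 0" using pos by auto
      moreover have "continuous_on {z - h..z + h} (\<lambda>y. \<sigma> z * e * D y)"
        unfolding D_def by (intro continuous_intros continuous_on_slow_displacement b)
      ultimately obtain y where "z - h \<le> y" "y \<le> z + h" "\<sigma> z * e * D y = 0"
        using IVT'[of "\<lambda>y. \<sigma> z * e * D y" "z - h" 0 "z + h"] h_pos by auto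
      then show ?thesis using \<sigma>[OF z] \<open>e \<noteq> 0\<close> by (intro exI[of _ y]) (auto simp: abs_le_iff)
    qed
    then obtain g where g: "\<And>z. z \<in> Z \<Longrightarrow> \<bar>g z - z\<bar> \<le> h \<and> D (g z) = 0" by metis
    have "bij_betw g Z {y. D y = 0}"
    proof (rule bij_betwI')
      fix z z' assume zz: "z \<in> Z" "z' \<in> Z"
      show "g z = g z' \<longleftrightarrow> z = z'"
      proof
        assume eq: "g z = g z'"
        have "\<bar>z - z'\<bar> \<le> 2 * h" using g[OF zz(1)] g[OF zz(2)] unfolding eq by linarith
        then show "z = z'" using sep zz by force
      qed simp
    next
      fix y assume y: "y \<in> {y. D y = 0}"
      then have "\<not> R \<le> \<bar>y\<bar>" "y \<notin> K" using elim(3) sign[of y] by (auto simp: D_def)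
      moreover from this have "y \<in> {- R..R}" by auto
      ultimately have "y \<in> (\<Union>z\<in>Z. ball z h)" unfolding K_def by blast
      then obtain z where "z \<in> Z" "y \<in> ball z h" by blast
      then have "\<bar>y - z\<bar> < h" by (simp add: dist_real_def abs_minus_commute)
      then have "y = g z" using y g[of z] \<open>z \<in> Z\<close> by (auto intro: unique[of z y "g z"])
      then show "\<exists>z\<in>Z. y = g z" using \<open>z \<in> Z\<close> by blast
    qed (use g in auto)
    then have "finite {y. D y = 0} \<and> card {y. D y = 0} = card Z"
      using Z(1) bij_betw_finite[of g Z] bij_betw_same_card[of g Z] by simp
    then show ?case unfolding D_def .
  qed
qed

lemma card_limit_cycles_eventually:
  assumes b: "0 < b" "b < 1" and Z: "finite Z" "\<And>y. avg b \<mu> y = 0 \<longleftrightarrow> y \<in> Z"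
    and simple: "\<forall>z\<in>Z. \<exists>p q. (ramp_integral \<mu> has_real_derivative p) (at z) \<and>
      (ramp_integral \<mu> has_real_derivative q) (at (- z)) \<and> 2 * pi * b - p - q \<noteq> 0"
  shows "\<forall>\<^sub>F e in at 0. card {u. limit_cycle (b - 1) b e \<mu> u} = card Z"
  using card_zeros_slow_displacement[OF assms]
proof eventually_elim
  case (elim e)
  have eq: "{y. slow_displacement b e \<mu> y = 0} = (\<lambda>x. x + \<mu>) ` {x. displacement (b - 1) b e \<mu> x = 0}"
    by (auto simp: image_iff intro!: exI[of _ "_ - \<mu>"])
  have inj: "inj_on (\<lambda>x. x + \<mu>) X" for X by (simp add: inj_on_def)
  from elim have "finite {x. displacement (b - 1) b e \<mu> x = 0}"
    unfolding eq using finite_imageD[OF _ inj] by blast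
  moreover have "card {x. displacement (b - 1) b e \<mu> x = 0} = card Z"
    using elim unfolding eq by (simp add: card_image[OF inj])
  ultimately show ?case by (simp add: card_limit_cycles)
qed

subsection \<open>Zeros of the averaged function\<close>

text \<open>For \<open>\<mu> > 0\<close> this is the quantity \<alpha> of the introduction: the ramp
  in the form \<open>y - 1 + \<mu> * cos t\<close> is positive on the half period exactly before
  this time. The truncation gives 0 if that never happens and \<open>pi\<close> if it always
  does.\<close>

definition angle :: "real \<Rightarrow> real \<Rightarrow> real" where
  "angle \<mu> y = arccos (max (-1) (min 1 ((1 - y) / \<mu>)))"

lemma angle_range: "0 \<le> angle \<mu> y" "angle \<mu> y \<le> pi"
  unfolding angle_def by (auto intro!: arccos_lbound arccos_ubound)

lemma cos_angle: "cos (angle \<mu> y) = max (-1) (min 1 ((1 - y) / \<mu>))"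
  unfolding angle_def by (rule cos_arccos) auto

text \<open>For \<theta> strictly between 0 and \<open>pi\<close> the cosine is strictly between -1
  and 1, so the truncation in \<open>angle\<close> does not affect the comparison.\<close>

lemma angle_less_iff:
  assumes "\<mu> > 0" "0 < \<theta>" "\<theta> < pi"
  shows "angle \<mu> y < \<theta> \<longleftrightarrow> y < 1 - \<mu> * cos \<theta>"
proof -
  have "angle \<mu> y < \<theta> \<longleftrightarrow> cos \<theta> < cos (angle \<mu> y)"
    using assms angle_range by (subst cos_mono_less_eq) auto
  moreover have "-1 < cos \<theta>" "cos \<theta> < 1"
    using assms cos_monotone_0_pi[of \<theta> pi] cos_monotone_0_pi[of 0 \<theta>] by auto
  ultimately have "angle \<mu> y < \<theta> \<longleftrightarrow> cos \<theta> < (1 - y) / \<mu>"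
    by (auto simp: cos_angle max_def min_def)
  then show ?thesis using assms by (simp add: pos_less_divide_eq mult.commute less_diff_eq add.commute)
qed

lemma less_angle_iff:
  assumes "\<mu> > 0" "0 < \<theta>" "\<theta> < pi"
  shows "\<theta> < angle \<mu> y \<longleftrightarrow> 1 - \<mu> * cos \<theta> < y"
proof -
  have "\<theta> < angle \<mu> y \<longleftrightarrow> cos (angle \<mu> y) < cos \<theta>"
    using assms angle_range by (subst cos_mono_less_eq) auto
  moreover have "-1 < cos \<theta>" "cos \<theta> < 1"
    using assms cos_monotone_0_pi[of \<theta> pi] cos_monotone_0_pi[of 0 \<theta>] by auto
  ultimately have "\<theta> < angle \<mu> y \<longleftrightarrow> (1 - y) / \<mu> < cos \<theta>"
    by (auto simp: cos_angle max_def min_def)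
  then show ?thesis using assms by (simp add: pos_divide_less_eq mult.commute) linarith
qed

lemma angle_eq_0: "\<mu> > 0 \<Longrightarrow> y \<le> 1 - \<mu> \<Longrightarrow> angle \<mu> y = 0"
  by (simp add: angle_def min_def pos_divide_less_eq le_divide_eq)

lemma angle_eq_pi: "\<mu> > 0 \<Longrightarrow> 1 + \<mu> \<le> y \<Longrightarrow> angle \<mu> y = pi"
proof -
  assume "\<mu> > 0" "1 + \<mu> \<le> y"
  then have "(1 - y) / \<mu> \<le> -1" by (simp add: pos_divide_le_eq)
  then have "max (-1) (min 1 ((1 - y) / \<mu>)) = -1" by auto
  then show ?thesis by (simp add: angle_def)
qed

lemma continuous_angle:
  assumes "\<mu> > 0"
  shows "isCont (angle \<mu>) y"
proof -
  have "continuous_on UNIV (angle \<mu>)"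
    unfolding angle_def[abs_def] using assms by (intro continuous_intros continuous_on_arccos) auto
  then show ?thesis by (simp add: continuous_on_eq_continuous_at)
qed

lemma ramp_has_integral:
  fixes y \<mu> \<theta> :: real
  assumes "0 \<le> \<theta>"
  shows "((\<lambda>t. y - 1 + \<mu> * cos t) has_integral (y - 1) * \<theta> + \<mu> * sin \<theta>) {0..\<theta>}"
proof -
  have "((\<lambda>t. y - 1 + \<mu> * cos t) has_integral
      (\<lambda>t. (y - 1) * t + \<mu> * sin t) \<theta> - (\<lambda>t. (y - 1) * t + \<mu> * sin t) 0) {0..\<theta>}"
    by (rule fundamental_theorem_of_calculus[OF assms])
      (auto intro!: derivative_eq_intros simp flip: has_real_derivative_iff_has_vector_derivative)
  then show ?thesis by simp
qed

lemma ramp_integral_plus: "ramp_integral \<mu> y = 2 * integral {0..pi} (\<lambda>t. max 0 (y - 1 + \<mu> * cos t))"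
  using ramp_integral_eq[of "- \<mu>" y] by simp

lemma ramp_integrable_plus: "(\<lambda>t. max 0 (y - 1 + \<mu> * cos t)) integrable_on {c..d}" for y :: real
  using ramp_integrable[of y "- \<mu>" c d] by simp

text \<open>Dropping the truncation on the part up to \<theta> and the nonnegative remainder can
  only decrease the integral. The free choice of \<theta> makes this usable as a test
  inequality.\<close>

lemma ramp_integral_ge:
  assumes "0 \<le> \<theta>" "\<theta> \<le> pi"
  shows "2 * ((y - 1) * \<theta> + \<mu> * sin \<theta>) \<le> ramp_integral \<mu> y"
proof -
  have "(y - 1) * \<theta> + \<mu> * sin \<theta> \<le> integral {0..\<theta>} (\<lambda>t. max 0 (y - 1 + \<mu> * cos t))"
    by (rule has_integral_le[OF ramp_has_integral integrable_integral[OF ramp_integrable_plus]])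
      (use assms in auto)
  also have "\<dots> \<le> integral {0..pi} (\<lambda>t. max 0 (y - 1 + \<mu> * cos t))"
    by (intro integral_subset_le ramp_integrable_plus) (use assms in auto)
  finally show ?thesis by (simp add: ramp_integral_plus)
qed

lemma ramp_integral_angle:
  assumes "\<mu> > 0"
  shows "ramp_integral \<mu> y = 2 * ((y - 1) * angle \<mu> y + \<mu> * sin (angle \<mu> y))"
proof -
  define \<alpha> where "\<alpha> = angle \<mu> y"
  have \<alpha>: "0 \<le> \<alpha>" "\<alpha> \<le> pi" using angle_range by (auto simp: \<alpha>_def)
  let ?w = "\<lambda>t. max 0 (y - 1 + \<mu> * cos t)"
  have "integral {0..\<alpha>} ?w = (y - 1) * \<alpha> + \<mu> * sin \<alpha>"
  proof (cases "\<alpha> = 0")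
    case False
    have "?w t = y - 1 + \<mu> * cos t" if t: "t \<in> {0..\<alpha>}" for t
    proof -
      \<comment> \<open>A nonzero angle means that the truncation at 1 is inactive; truncation at -1
        only raises the value, so the inequality holds in either case.\<close>
      have "cos \<alpha> \<noteq> 1" using False \<alpha> cos_monotone_0_pi[of 0 \<alpha>] by auto
      then have "(1 - y) / \<mu> \<le> cos \<alpha>" by (auto simp: \<alpha>_def cos_angle max_def min_def split: if_splits)
      also have "\<dots> \<le> cos t" using t \<alpha> by (intro cos_monotone_0_pi_le) auto
      finally show ?thesis using assms by (simp add: pos_divide_le_eq mult.commute)
    qed
    then have "integral {0..\<alpha>} ?w = integral {0..\<alpha>} (\<lambda>t. y - 1 + \<mu> * cos t)"
      by (rule integral_cong)
    then show ?thesis using ramp_has_integral[OF \<alpha>(1)] by (simp add: integral_unique)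
  qed simp
  moreover have "integral {\<alpha>..pi} ?w = 0"
  proof (cases "\<alpha> = pi")
    case False
    have "?w t = 0" if t: "t \<in> {\<alpha>..pi}" for t
    proof -
      have "cos \<alpha> \<noteq> -1" using False \<alpha> cos_monotone_0_pi[of \<alpha> pi] by auto
      have "cos t \<le> cos \<alpha>" using t \<alpha> by (intro cos_monotone_0_pi_le) auto
      also have "\<dots> \<le> (1 - y) / \<mu>"
        using \<open>cos \<alpha> \<noteq> -1\<close> by (auto simp: \<alpha>_def cos_angle max_def min_def split: if_splits)
      finally show ?thesis using assms by (simp add: pos_le_divide_eq mult.commute)
    qed
    then have "integral {\<alpha>..pi} ?w = integral {\<alpha>..pi} (\<lambda>t. 0)"
      by (rule integral_cong)
    then show ?thesis by simp
  qed simp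
  ultimately have "integral {0..pi} ?w = (y - 1) * \<alpha> + \<mu> * sin \<alpha>"
    using Henstock_Kurzweil_Integration.integral_combine[of 0 \<alpha> pi ?w] \<alpha> ramp_integrable_plus by auto
  then show ?thesis by (simp add: ramp_integral_plus \<alpha>_def)
qed

text \<open>Envelope theorem: \<open>ramp_integral \<mu> y\<close> is the maximum over \<open>\<theta>\<close> of
  \<open>2 ((y - 1) \<theta> + \<mu> sin \<theta>)\<close>, attained at \<open>\<theta> = angle \<mu> y\<close>.\<close>

lemma has_derivative_ramp_integral:
  assumes "\<mu> > 0"
  shows "(ramp_integral \<mu> has_real_derivative 2 * angle \<mu> y) (at y)"
proof -
  have "((\<lambda>h. (ramp_integral \<mu> (y + h) - ramp_integral \<mu> y) / h - 2 * angle \<mu> y) \<longlongrightarrow> 0) (at 0)"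
  proof (rule Lim_null_comparison)
    have "((\<lambda>h. angle \<mu> (y + h)) \<longlongrightarrow> angle \<mu> y) (at 0)"
      using continuous_angle[OF assms, of y] by (simp add: isCont_iff)
    then show "((\<lambda>h. 2 * \<bar>angle \<mu> (y + h) - angle \<mu> y\<bar>) \<longlongrightarrow> 0) (at 0)"
      by (auto intro!: tendsto_eq_intros)
    have "norm ((ramp_integral \<mu> (y + h) - ramp_integral \<mu> y) / h - 2 * angle \<mu> y) \<le>
        2 * \<bar>angle \<mu> (y + h) - angle \<mu> y\<bar>" if "h \<noteq> 0" for h
    proof -
      \<comment> \<open>Testing the integral at \<open>y + h\<close> with the angle of
        \<open>y\<close>, and the integral at \<open>y\<close> with the angle of
        \<open>y + h\<close>, traps the increment between \<open>2 * angle \<mu> y * h\<close> and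
        \<open>2 * angle \<mu> (y + h) * h\<close>.\<close>
      have "ramp_integral \<mu> (y + h) - ramp_integral \<mu> y - 2 * angle \<mu> y * h \<ge> 0"
        using ramp_integral_ge[OF angle_range[of \<mu> y], of "y + h" \<mu>]
        unfolding ramp_integral_angle[OF assms, of y] by (simp add: algebra_simps)
      moreover have "ramp_integral \<mu> (y + h) - ramp_integral \<mu> y - 2 * angle \<mu> (y + h) * h \<le> 0"
        using ramp_integral_ge[OF angle_range[of \<mu> "y + h"], of y \<mu>]
        unfolding ramp_integral_angle[OF assms, of "y + h"] by (simp add: algebra_simps)
      moreover have "(angle \<mu> (y + h) - angle \<mu> y) * h \<le> \<bar>angle \<mu> (y + h) - angle \<mu> y\<bar> * \<bar>h\<bar>"
        by (metis abs_ge_self abs_mult)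
      ultimately have "\<bar>ramp_integral \<mu> (y + h) - ramp_integral \<mu> y - 2 * angle \<mu> y * h\<bar> \<le>
          2 * \<bar>angle \<mu> (y + h) - angle \<mu> y\<bar> * \<bar>h\<bar>"
        by (simp add: algebra_simps)
      moreover have "ramp_integral \<mu> (y + h) - ramp_integral \<mu> y - 2 * angle \<mu> y * h =
          ((ramp_integral \<mu> (y + h) - ramp_integral \<mu> y) / h - 2 * angle \<mu> y) * h"
        using that by (subst left_diff_distrib) simp
      ultimately show ?thesis using that by (simp add: abs_mult)
    qed
    then show "\<forall>\<^sub>F h in at 0. norm ((ramp_integral \<mu> (y + h) - ramp_integral \<mu> y) / h - 2 * angle \<mu> y) \<le>
        2 * \<bar>angle \<mu> (y + h) - angle \<mu> y\<bar>"
      by (auto simp: eventually_at_filter)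
  qed
  then show ?thesis by (simp add: DERIV_def LIM_zero_iff)
qed

lemma has_derivative_avg:
  assumes "\<mu> > 0"
  shows "(avg b \<mu> has_real_derivative 2 * (pi * b - angle \<mu> y - angle \<mu> (- y))) (at y)"
  unfolding avg_eq[abs_def]
  by (auto intro!: derivative_eq_intros has_derivative_ramp_integral[OF assms]
      DERIV_chain2[of "ramp_integral \<mu>"])

text \<open>The sum of the two cosines is constant in \<open>y\<close> while their difference grows, so by the
  sum-to-product formula the sum of the two angles decreases.\<close>

lemma angle_sum_strict_decreasing:
  assumes "0 \<le> y1" "y1 < y2" "y2 \<le> \<mu> - 1"
  shows "angle \<mu> y2 + angle \<mu> (- y2) < angle \<mu> y1 + angle \<mu> (- y1)"
proof (rule ccontr)
  have \<mu>: "\<mu> > 0" using assms by simp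
  define A B where "A y = (angle \<mu> y + angle \<mu> (- y)) / 2" and "B y = (angle \<mu> y - angle \<mu> (- y)) / 2" for y
  have cosang: "cos (angle \<mu> y) = (1 - y) / \<mu>" if "\<bar>y\<bar> \<le> \<mu> - 1" for y
    using that \<mu> by (auto simp: cos_angle max_def min_def field_simps)
  have mono: "angle \<mu> y < angle \<mu> y'" if "y < y'" "\<bar>y\<bar> \<le> \<mu> - 1" "\<bar>y'\<bar> \<le> \<mu> - 1" for y y'
  proof -
    have "cos (angle \<mu> y') < cos (angle \<mu> y)"
      using that \<mu> by (simp add: cosang divide_strict_right_mono)
    then show ?thesis using angle_range by (subst (asm) cos_mono_less_eq) auto
  qed
  have prod: "cos (A y) * cos (B y) = 1 / \<mu>" if "\<bar>y\<bar> \<le> \<mu> - 1" for y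
  proof -
    have "cos (A y) * cos (B y) = (cos (angle \<mu> y) + cos (angle \<mu> (- y))) / 2"
      by (simp add: A_def B_def cos_times_cos field_simps)
    then show ?thesis using that \<mu> by (simp add: cosang add_divide_distrib[symmetric])
  qed
  have r: "0 \<le> A y" "A y \<le> pi" "B y \<le> pi / 2" for y
    using angle_range[of \<mu> y] angle_range[of \<mu> "- y"] by (auto simp: A_def B_def)
  have B1: "0 \<le> B y1" using mono[of "- y1" y1] assms by (cases "y1 = 0") (auto simp: B_def)
  have "B y1 < B y2"
    using mono[of y1 y2] mono[of "- y2" "- y1"] assms by (simp add: B_def)
  then have cosB: "cos (B y2) < cos (B y1)"
    using B1 r(3)[of y2] by (intro cos_monotone_0_pi) auto
  have p: "cos (A y1) * cos (B y1) = 1 / \<mu>" "cos (A y2) * cos (B y2) = 1 / \<mu>"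
    using prod assms by auto
  \<comment> \<open>The product of the two cosines is \<open>1 / \<mu>\<close>, so nonnegativity of
    one factor makes both positive.\<close>
  have "cos (B y2) \<ge> 0" using B1 \<open>B y1 < B y2\<close> r(3)[of y2] by (intro cos_ge_zero) auto
  have "cos (A y2) > 0" "cos (B y2) > 0"
    using p(2) \<mu> \<open>cos (B y2) \<ge> 0\<close> by (metis divide_pos_pos less_eq_real_def mult_zero_right zero_less_mult_pos2 zero_less_one)+
  assume "\<not> angle \<mu> y2 + angle \<mu> (- y2) < angle \<mu> y1 + angle \<mu> (- y1)"
  \<comment> \<open>If the half sum \<open>A\<close> did not decrease, both cosines would be at most
    their earlier values, one of them strictly less, and the product could not stay
    constant.\<close>
  then have "A y1 \<le> A y2" by (simp add: A_def)
  then have "cos (A y2) \<le> cos (A y1)" using r by (intro cos_monotone_0_pi_le) auto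
  then have "cos (A y2) * cos (B y2) < cos (A y1) * cos (B y1)"
    using cosB \<open>cos (A y2) > 0\<close> \<open>cos (B y2) > 0\<close> by (intro mult_le_less_imp_less) auto
  then show False using p by simp
qed

subsection \<open>Counting limit cycles\<close>

text \<open>\<open>avg\<close> is odd, and passing from \<open>z\<close> to \<open>- z\<close>
  exchanges \<open>p\<close> and \<open>q\<close>. Simplicity is stated through \<open>p\<close> and
  \<open>q\<close> rather than angles to cover \<open>\<mu> = 0\<close> too.\<close>

lemma card_limit_cycles_odd:
  assumes b: "0 < b" "b < 1" and Z: "finite Z" "\<forall>z\<in>Z. 0 < z" "\<forall>y>0. avg b \<mu> y = 0 \<longleftrightarrow> y \<in> Z"
    and simple: "\<forall>z\<in>insert 0 Z. \<exists>p q. (ramp_integral \<mu> has_real_derivative p) (at z) \<and>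
      (ramp_integral \<mu> has_real_derivative q) (at (- z)) \<and> 2 * pi * b - p - q \<noteq> 0"
  shows "\<forall>\<^sub>F e in at 0. card {u. limit_cycle (b - 1) b e \<mu> u} = 2 * card Z + 1"
proof -
  let ?Z = "insert 0 (Z \<union> uminus ` Z)"
  have "avg b \<mu> y = 0 \<longleftrightarrow> y \<in> ?Z" for y
  proof (cases y "0 :: real" rule: linorder_cases)
    case less
    then have "avg b \<mu> y = 0 \<longleftrightarrow> - y \<in> Z" using Z(3)[rule_format, of "- y"] by (simp add: avg_minus)
    also have "\<dots> \<longleftrightarrow> y \<in> uminus ` Z" by (metis image_iff minus_minus)
    finally show ?thesis using less Z(2) by auto
  next
    case equal
    then show ?thesis by (simp add: avg_eq)
  next
    case greater
    then show ?thesis using Z by fastforce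
  qed
  moreover have "\<forall>z\<in>?Z. \<exists>p q. (ramp_integral \<mu> has_real_derivative p) (at z) \<and>
      (ramp_integral \<mu> has_real_derivative q) (at (- z)) \<and> 2 * pi * b - p - q \<noteq> 0"
  proof
    fix z assume "z \<in> ?Z"
    then consider "z \<in> insert 0 Z" | "- z \<in> Z" by auto
    then show "\<exists>p q. (ramp_integral \<mu> has_real_derivative p) (at z) \<and>
      (ramp_integral \<mu> has_real_derivative q) (at (- z)) \<and> 2 * pi * b - p - q \<noteq> 0"
    proof cases
      case 2
      then obtain p q where "(ramp_integral \<mu> has_real_derivative p) (at (- z))"
        "(ramp_integral \<mu> has_real_derivative q) (at z)" "2 * pi * b - p - q \<noteq> 0"
        using simple[rule_format, of "- z"] by auto
      then show ?thesis by (intro exI[of _ q] exI[of _ p]) auto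
    qed (use simple in blast)
  qed
  ultimately have "\<forall>\<^sub>F e in at 0. card {u. limit_cycle (b - 1) b e \<mu> u} = card ?Z"
    using Z(1) by (intro card_limit_cycles_eventually[OF b] finite_insert[THEN iffD2] finite_UnI finite_imageI)
  moreover have "card ?Z = 2 * card Z + 1"
  proof -
    have "Z \<inter> uminus ` Z = {}"
    proof (rule equals0I)
      fix x assume "x \<in> Z \<inter> uminus ` Z"
      then have "0 < x" "x < 0" using Z(2) by auto
      then show False by simp
    qed
    then have "card (Z \<union> uminus ` Z) = card Z + card (uminus ` Z)"
      using Z(1) by (intro card_Un_disjoint) auto
    also have "card (uminus ` Z) = card Z" by (rule card_image) (simp add: inj_on_def)
    finally show ?thesis using Z(1,2) by (subst card_insert_disjoint) auto
  qed
  ultimately show ?thesis by simp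
qed

lemma ramp_integral_abs: "ramp_integral \<bar>\<mu>\<bar> = ramp_integral \<mu>"
  by (auto simp: abs_if)

lemma avg_abs: "avg b \<bar>\<mu>\<bar> = avg b \<mu>"
  by (simp add: avg_eq[abs_def] ramp_integral_abs)

lemma card_limit_cycles_angle:
  assumes b: "0 < b" "b < 1" and \<mu>: "\<mu> \<noteq> 0"
    and Z: "finite Z" "\<forall>z\<in>Z. 0 < z" "\<forall>y>0. avg b \<bar>\<mu>\<bar> y = 0 \<longleftrightarrow> y \<in> Z"
    and simple: "\<forall>z\<in>insert 0 Z. angle \<bar>\<mu>\<bar> z + angle \<bar>\<mu>\<bar> (- z) \<noteq> pi * b"
  shows "\<forall>\<^sub>F e in at 0. card {u. limit_cycle (b - 1) b e \<mu> u} = 2 * card Z + 1"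
proof (rule card_limit_cycles_odd[OF b Z(1,2)])
  show "\<forall>z\<in>insert 0 Z. \<exists>p q. (ramp_integral \<mu> has_real_derivative p) (at z) \<and>
      (ramp_integral \<mu> has_real_derivative q) (at (- z)) \<and> 2 * pi * b - p - q \<noteq> 0"
  proof
    fix z assume "z \<in> insert 0 Z"
    then have "2 * pi * b - 2 * angle \<bar>\<mu>\<bar> z - 2 * angle \<bar>\<mu>\<bar> (- z) \<noteq> 0"
      using simple by force
    then show "\<exists>p q. (ramp_integral \<mu> has_real_derivative p) (at z) \<and>
      (ramp_integral \<mu> has_real_derivative q) (at (- z)) \<and> 2 * pi * b - p - q \<noteq> 0"
      using has_derivative_ramp_integral[of "\<bar>\<mu>\<bar>"] \<mu> unfolding ramp_integral_abs
      by (intro exI[of _ "2 * angle \<bar>\<mu>\<bar> z"] exI[of _ "2 * angle \<bar>\<mu>\<bar> (- z)"]) auto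
  qed
qed (use Z(3) in \<open>simp add: avg_abs\<close>)

text \<open>Without forcing, \<open>avg\<close> is \<open>2 * pi\<close> times \<open>pwl\<close>
  itself. Its zeros 0 and those of modulus \<open>1 / (1 - b)\<close> are away from the kinks, so
  the ramp integrals are differentiable there.\<close>

lemma card_limit_cycles_unforced:
  assumes b: "0 < b" "b < 1"
  shows "\<forall>\<^sub>F e in at 0. card {u. limit_cycle (b - 1) b e 0 u} = 3"
proof -
  have ramp: "ramp_integral 0 y = 2 * pi * max 0 (y - 1)" for y
    by (simp add: ramp_integral_def)
  have lin: "((\<lambda>y. 2 * pi * (y - 1)) has_real_derivative 2 * pi) (at y)" for y
    by (auto intro!: derivative_eq_intros)
  have d1: "(ramp_integral 0 has_real_derivative 2 * pi) (at y)" if "1 < y" for y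
    using that by (intro has_field_derivative_transform_within_open[OF lin, where S = "{1<..}"]) (auto simp: ramp)
  have d0: "(ramp_integral 0 has_real_derivative 0) (at y)" if "y < 1" for y
    using that by (intro has_field_derivative_transform_within_open[OF DERIV_const[of 0], where S = "{..<1}"])
      (auto simp: ramp)
  define z where "z = 1 / (1 - b)"
  have z: "1 < z" using b by (simp add: z_def)
  have "avg b 0 y = 0 \<longleftrightarrow> y = z" if "y > 0" for y
  proof -
    have "avg b 0 y = 2 * pi * (b * y - max 0 (y - 1))"
      using that by (simp add: avg_eq ramp algebra_simps)
    then have "avg b 0 y = 0 \<longleftrightarrow> b * y = max 0 (y - 1)" by simp
    also have "\<dots> \<longleftrightarrow> y * (1 - b) = 1" using mult_pos_pos[OF b(1) that] by (auto simp: max_def algebra_simps)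
    finally show ?thesis using b by (simp add: z_def nonzero_eq_divide_eq)
  qed
  then have "\<forall>\<^sub>F e in at 0. card {u. limit_cycle (b - 1) b e 0 u} = 2 * card {z} + 1"
  proof (intro card_limit_cycles_odd[OF b])
    have "\<exists>p q. (ramp_integral 0 has_real_derivative p) (at 0) \<and>
        (ramp_integral 0 has_real_derivative q) (at (- 0)) \<and> 2 * pi * b - p - q \<noteq> 0"
      using d0[of 0] b by (intro exI[of _ 0]) auto
    moreover have "\<exists>p q. (ramp_integral 0 has_real_derivative p) (at z) \<and>
        (ramp_integral 0 has_real_derivative q) (at (- z)) \<and> 2 * pi * b - p - q \<noteq> 0"
      using d1[of z] d0[of "- z"] z b by (intro exI[of _ "2 * pi"] exI[of _ 0]) auto
    ultimately show "\<forall>z\<in>insert 0 {z}. \<exists>p q. (ramp_integral 0 has_real_derivative p) (at z) \<and>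
        (ramp_integral 0 has_real_derivative q) (at (- z)) \<and> 2 * pi * b - p - q \<noteq> 0"
      by blast
  qed (use z in auto)
  then show ?thesis by simp
qed

section \<open>Trigonometric inequalities between the thresholds\<close>

lemma mult_cos_less_sin:
  fixes x :: real
  assumes "0 < x" "x < pi"
  shows "x * cos x < sin x"
proof -
  have "(\<lambda>x. sin x - x * cos x) 0 < (\<lambda>x. sin x - x * cos x) x"
  proof (rule DERIV_pos_imp_increasing_open[OF assms(1)])
    fix y assume "0 < y" "y < x"
    then show "\<exists>d. ((\<lambda>x. sin x - x * cos x) has_real_derivative d) (at y) \<and> 0 < d"
      using assms by (intro exI[of _ "y * sin y"]) (auto intro!: derivative_eq_intros mult_pos_pos sin_gt_zero)
  qed (intro continuous_intros)
  then show ?thesis by simp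
qed

lemma sin_less_self:
  fixes x :: real
  assumes "0 < x" "x < pi"
  shows "sin x < x"
proof -
  have "(\<lambda>x. x - sin x) 0 < (\<lambda>x. x - sin x) x"
  proof (rule DERIV_pos_imp_increasing_open[OF assms(1)])
    fix y assume "0 < y" "y < x"
    then show "\<exists>d. ((\<lambda>x. x - sin x) has_real_derivative d) (at y) \<and> 0 < d"
      using assms cos_monotone_0_pi[of 0 y]
      by (intro exI[of _ "1 - cos y"]) (auto intro!: derivative_eq_intros)
  qed (intro continuous_intros)
  then show ?thesis by simp
qed

text \<open>By the double angle formula, the last two inequalities are \<open>sin x < x\<close> and
  \<open>x * cos x < sin x\<close> at \<open>x = c / 2\<close>. The last one will place the peak
  \<open>1 - \<mu> * cos c\<close> beyond \<open>\<mu> - 1\<close> when \<mu> is below the upper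
  threshold.\<close>

lemma threshold_facts:
  fixes c :: real
  assumes "0 < c" "c < pi"
  shows "0 < cos (c / 2)" "cos (c / 2) < 1" "0 < sin (c / 2)" "0 < sin c" "cos c < 1"
    and "1 / cos (c / 2) < c / sin c" "c / sin c < 1 / (cos (c / 2))\<^sup>2"
proof -
  show c2: "0 < cos (c / 2)" using assms by (intro cos_gt_zero_pi) auto
  show "cos (c / 2) < 1" "cos c < 1"
    using assms cos_monotone_0_pi[of 0 "c / 2"] cos_monotone_0_pi[of 0 c] by auto
  show s2: "0 < sin (c / 2)" "0 < sin c" using assms by (auto intro: sin_gt_zero)
  have sc: "sin c = 2 * sin (c / 2) * cos (c / 2)" using sin_double[of "c / 2"] by simp
  have "sin (c / 2) < c / 2"
    using assms by (intro sin_less_self) auto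
  then show "1 / cos (c / 2) < c / sin c"
    using c2 s2 unfolding sc by (simp add: field_simps)
  show "c / sin c < 1 / (cos (c / 2))\<^sup>2"
    using mult_cos_less_sin[of "c / 2"] assms c2 s2 unfolding sc
    by (simp add: field_simps power2_eq_square)
qed

section \<open>Shape of the averaged function on the positive half line\<close>

lemma angle_peak:
  assumes b: "0 < b" "b < 1" and \<mu>: "\<mu> > 0"
  shows "angle \<mu> (1 - \<mu> * cos (pi * b)) = pi * b"
  using b \<mu> by (simp add: angle_def arccos_cos)

lemma avg_peak:
  assumes b: "0 < b" "b < 1" and \<mu>: "\<mu> > 0" and "\<mu> - 1 \<le> 1 - \<mu> * cos (pi * b)"
  shows "avg b \<mu> (1 - \<mu> * cos (pi * b)) = 2 * (pi * b - \<mu> * sin (pi * b))"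
proof -
  have "angle \<mu> (- (1 - \<mu> * cos (pi * b))) = 0" using assms by (intro angle_eq_0) auto
  then show ?thesis
    unfolding avg_eq ramp_integral_angle[OF \<mu>] angle_peak[OF b \<mu>] by (simp add: algebra_simps)
qed

text \<open>From \<open>\<mu> - 1\<close> on, the angle at \<open>- y\<close> is 0, and the angle at
  \<open>y\<close> reaches \<open>pi * b\<close> only at the peak.\<close>

lemma angle_sum_less:
  assumes b: "0 < b" "b < 1" and \<mu>: "\<mu> > 0" and y: "\<mu> - 1 \<le> y" "y < 1 - \<mu> * cos (pi * b)"
  shows "angle \<mu> y + angle \<mu> (- y) < pi * b"
  using angle_less_iff[OF \<mu>, of "pi * b" y] angle_eq_0[OF \<mu>, of "- y"] b y by simp

lemma avg_strict_increasing:
  assumes \<mu>: "\<mu> > 0" and "u < v" and "\<And>y. u < y \<Longrightarrow> y < v \<Longrightarrow> angle \<mu> y + angle \<mu> (- y) < pi * b"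
  shows "avg b \<mu> u < avg b \<mu> v"
proof (rule DERIV_pos_imp_increasing_open[OF \<open>u < v\<close>])
  fix y assume "u < y" "y < v"
  then show "\<exists>d. (avg b \<mu> has_real_derivative d) (at y) \<and> 0 < d"
    using has_derivative_avg[OF \<mu>, of b y] assms(3)[of y] by fastforce
qed (rule continuous_on_avg)

lemma avg_strict_decreasing:
  assumes \<mu>: "\<mu> > 0" and "u < v" and "\<And>y. u < y \<Longrightarrow> y < v \<Longrightarrow> pi * b < angle \<mu> y + angle \<mu> (- y)"
  shows "avg b \<mu> v < avg b \<mu> u"
proof (rule DERIV_neg_imp_decreasing_open[OF \<open>u < v\<close>])
  fix y assume "u < y" "y < v"
  then show "\<exists>d. (avg b \<mu> has_real_derivative d) (at y) \<and> d < 0"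
    using has_derivative_avg[OF \<mu>, of b y] assms(3)[of y] by fastforce
qed (rule continuous_on_avg)

lemma avg_zero_beyond_peak:
  assumes b: "0 < b" "b < 1" and \<mu>: "\<mu> > 0"
    and peak: "0 < avg b \<mu> (1 - \<mu> * cos (pi * b))"
  shows "\<exists>z>1 - \<mu> * cos (pi * b). angle \<mu> z + angle \<mu> (- z) \<noteq> pi * b \<and>
    (\<forall>y\<ge>1 - \<mu> * cos (pi * b). avg b \<mu> y = 0 \<longleftrightarrow> y = z)"
proof -
  define y0 where "y0 = 1 - \<mu> * cos (pi * b)"
  have s: "pi * b < angle \<mu> y + angle \<mu> (- y)" if "y0 < y" for y
    using less_angle_iff[OF \<mu>, of "pi * b" y] angle_range(1)[of \<mu> "- y"] that b by (simp add: y0_def)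
  have decr: "avg b \<mu> v < avg b \<mu> u" if "y0 \<le> u" "u < v" for u v
    using that s by (intro avg_strict_decreasing[OF \<mu>]) auto
  \<comment> \<open>Beyond \<open>1 + \<mu>\<close> the upper ramp is never truncated and the lower
    one vanishes, so \<open>avg\<close> is affine there; the extra \<open>1 / (1 - b)\<close> makes
    it negative.\<close>
  define Y where "Y = 1 + \<mu> + 1 / (1 - b)"
  have Y: "1 + \<mu> \<le> Y" using b by (simp add: Y_def)
  then have "angle \<mu> Y = pi" "angle \<mu> (- Y) = 0"
    using \<mu> by (auto intro!: angle_eq_pi angle_eq_0)
  then have "avg b \<mu> Y = 2 * pi * (1 - (1 - b) * Y)"
    unfolding avg_eq ramp_integral_angle[OF \<mu>] by (simp add: algebra_simps)
  moreover have "(1 - b) * Y = (1 - b) * (1 + \<mu>) + 1" using b by (simp add: Y_def algebra_simps)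
  moreover have "(1 - b) * (1 + \<mu>) > 0" using b \<mu> by simp
  ultimately have "avg b \<mu> Y < 0" by (simp add: mult_less_0_iff)
  moreover have "\<mu> * - cos (pi * b) \<le> \<mu> * 1" using \<mu> by (intro mult_left_mono) auto
  then have "y0 \<le> Y" using Y by (simp add: y0_def)
  ultimately obtain z where z: "y0 \<le> z" "avg b \<mu> z = 0"
    using IVT2'[of "avg b \<mu>" Y 0 y0] peak continuous_on_avg by (auto simp: y0_def)
  then have "y0 < z" using peak by (cases "y0 = z") (auto simp: y0_def)
  moreover have "avg b \<mu> y = 0 \<longleftrightarrow> y = z" if "y \<ge> y0" for y
    using decr[of y z] decr[of z y] z that by (cases y z rule: linorder_cases) auto
  ultimately show ?thesis using s[of z] unfolding y0_def by (intro exI[of _ z]) auto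
qed

section \<open>Limit cycles in the three ranges of the forcing amplitude\<close>

text \<open>The angle sum starts below \<open>c\<close> at 0 and stays below it up to the peak
  \<open>y0\<close>, so \<open>avg\<close> increases from 0 to a positive value; the only positive
  zero lies beyond the peak.\<close>

lemma card_limit_cycles_weak:
  assumes b: "0 < b" "b < 1" and lt: "\<bar>\<mu>\<bar> < 1 / cos (pi * b / 2)"
  shows "\<forall>\<^sub>F e in at 0. card {u. limit_cycle (b - 1) b e \<mu> u} = 3"
proof (cases "\<mu> = 0")
  case True
  then show ?thesis using card_limit_cycles_unforced[OF b] by simp
next
  case False
  define m c where "m = \<bar>\<mu>\<bar>" and "c = pi * b"
  have m: "m > 0" using False by (simp add: m_def)
  have c: "0 < c" "c < pi" using b by (auto simp: c_def)
  note th = threshold_facts[OF c]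
  have mc: "m * cos (c / 2) < 1" using lt th(1) by (simp add: m_def c_def field_simps)
  define y0 where "y0 = 1 - m * cos c"
  have "1 + cos c = 2 * (cos (c / 2))\<^sup>2" using cos_double_cos[of "c / 2"] by simp
  moreover have "(m * cos (c / 2)) * cos (c / 2) < 1 * 1"
    using mc th(1,2) m by (intro mult_strict_mono) auto
  ultimately have "m * (1 + cos c) < 2" by (simp add: power2_eq_square)
  then have y0: "m - 1 < y0" by (simp add: y0_def algebra_simps)
  \<comment> \<open>For \<open>m \<le> 1\<close> the bound \<open>m - 1 < y0\<close> does not give
    positivity, and \<open>m * cos c < 1\<close> is shown directly.\<close>
  have y0_pos: "0 < y0"
  proof (cases "m \<le> 1")
    case True
    have "m * cos c < 1"
    proof (cases "cos c \<le> 0")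
      case True
      then show ?thesis using m by (smt (verit) mult_nonneg_nonpos)
    next
      case False
      then have "m * cos c \<le> 1 * cos c" using True by (intro mult_right_mono) auto
      then show ?thesis using th(5) by simp
    qed
    then show ?thesis by (simp add: y0_def)
  qed (use y0 in simp)
  have "angle m 0 < c / 2" using angle_less_iff[OF m, of "c / 2" 0] mc c by simp
  then have s0: "angle m 0 + angle m (- 0) < c" by simp
  have s: "angle m y + angle m (- y) < c" if "0 \<le> y" "y < y0" for y
  proof (cases "m - 1 \<le> y")
    case True
    then show ?thesis using angle_sum_less[OF b m True] that by (simp add: y0_def c_def)
  next
    case False
    then show ?thesis
      using s0 angle_sum_strict_decreasing[of 0 y m] that by (cases "y = 0") auto
  qed
  have pos: "0 < avg b m y" if "0 < y" "y \<le> y0" for y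
    using avg_strict_increasing[OF m \<open>0 < y\<close>, of b] s that by (simp add: c_def avg_eq[of b m 0])
  obtain z where z: "z > y0" "angle m z + angle m (- z) \<noteq> c" "\<forall>y\<ge>y0. avg b m y = 0 \<longleftrightarrow> y = z"
    using avg_zero_beyond_peak[OF b m] pos[of y0] y0_pos unfolding y0_def c_def by auto
  have "\<forall>\<^sub>F e in at 0. card {u. limit_cycle (b - 1) b e \<mu> u} = 2 * card {z} + 1"
  proof (rule card_limit_cycles_angle[OF b False])
    show "\<forall>y>0. avg b \<bar>\<mu>\<bar> y = 0 \<longleftrightarrow> y \<in> {z}"
    proof (intro allI impI)
      fix y :: real assume "y > 0"
      then show "avg b \<bar>\<mu>\<bar> y = 0 \<longleftrightarrow> y \<in> {z}"
        using pos[of y] z by (cases "y \<le> y0") (auto simp: m_def)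
    qed
    show "\<forall>z\<in>insert 0 {z}. angle \<bar>\<mu>\<bar> z + angle \<bar>\<mu>\<bar> (- z) \<noteq> pi * b"
      using s0 z by (auto simp: m_def c_def)
  qed (use z y0_pos in auto)
  then show ?thesis by simp
qed

text \<open>The angle sum now starts above \<open>c\<close>, falls below it at some
  \<open>y1\<close>, and exceeds it again after the peak \<open>y0\<close>. Thus \<open>avg\<close>
  first decreases from 0, then rises to a positive peak, then decreases, giving one positive zero on
  each side of the peak.\<close>

lemma card_limit_cycles_medium:
  assumes b: "0 < b" "b < 1" and gt: "1 / cos (pi * b / 2) < \<bar>\<mu>\<bar>" and lt: "\<bar>\<mu>\<bar> < pi * b / sin (pi * b)"
  shows "\<forall>\<^sub>F e in at 0. card {u. limit_cycle (b - 1) b e \<mu> u} = 5"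
proof -
  define m c where "m = \<bar>\<mu>\<bar>" and "c = pi * b"
  have c: "0 < c" "c < pi" using b by (auto simp: c_def)
  note th = threshold_facts[OF c]
  have mc: "1 < m * cos (c / 2)" using gt th(1) by (simp add: m_def c_def field_simps)
  have "1 < 1 / cos (c / 2)" using th(1,2) by simp
  then have m: "m > 1" using gt by (simp add: m_def c_def)
  then have m0: "m > 0" by simp
  define y0 where "y0 = 1 - m * cos c"
  have "m < 1 / (cos (c / 2))\<^sup>2" using lt th(7) by (simp add: m_def c_def)
  then have "m * (2 * (cos (c / 2))\<^sup>2) < 2" using th(1) by (simp add: field_simps)
  moreover have "1 + cos c = 2 * (cos (c / 2))\<^sup>2" using cos_double_cos[of "c / 2"] by simp
  ultimately have "m * (1 + cos c) < 2" by simp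
  then have y0: "m - 1 < y0" by (simp add: y0_def algebra_simps)
  have "m * sin c < c" using lt th(4) by (simp add: m_def c_def field_simps)
  then have peak: "0 < avg b m y0"
    using avg_peak[OF b m0] y0 by (simp add: y0_def c_def)
  have "c / 2 < angle m 0" using less_angle_iff[OF m0, of "c / 2" 0] mc c by simp
  then have s0: "c < angle m 0 + angle m (- 0)" by simp
  define s where "s y = angle m y + angle m (- y)" for y
  have "continuous_on {0..m - 1} s"
    unfolding s_def
    by (auto intro!: continuous_at_imp_continuous_on continuous_intros continuous_angle[OF m0]
        isCont_o2[of _ uminus "angle m"])
  moreover have "s (m - 1) < c" using angle_sum_less[OF b m0 order_refl] y0 by (simp add: s_def y0_def c_def)
  ultimately obtain y1 where y1: "0 \<le> y1" "y1 \<le> m - 1" "s y1 = c"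
    using IVT2'[of s "m - 1" c 0] s0 m by (auto simp: s_def)
  have "y1 \<noteq> 0" using y1 s0 by (auto simp: s_def)
  then have y1_pos: "0 < y1" using y1 by simp
  have sl: "c < s y" if "0 \<le> y" "y < y1" for y
    using angle_sum_strict_decreasing[of y y1 m] y1 that by (simp add: s_def)
  have sr: "s y < c" if "y1 < y" "y < y0" for y
  proof (cases "m - 1 \<le> y")
    case True
    then show ?thesis using angle_sum_less[OF b m0 True] that by (simp add: s_def y0_def c_def)
  next
    case False
    then show ?thesis
      using angle_sum_strict_decreasing[of y1 y m] y1 that by (simp add: s_def)
  qed
  have neg: "avg b m y < 0" if "0 < y" "y \<le> y1" for y
    using avg_strict_decreasing[OF m0 \<open>0 < y\<close>, of b] sl that by (simp add: s_def c_def avg_eq[of b m 0])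
  have incr: "avg b m u < avg b m v" if "y1 \<le> u" "u < v" "v \<le> y0" for u v
    using sr that by (intro avg_strict_increasing[OF m0 \<open>u < v\<close>]) (simp add: s_def c_def)
  obtain z1 where z1: "y1 \<le> z1" "z1 \<le> y0" "avg b m z1 = 0"
    using IVT'[of "avg b m" y1 0 y0] neg[of y1] y1 y1_pos peak y0 continuous_on_avg by auto
  have "z1 \<noteq> y1" "z1 \<noteq> y0" using z1 peak neg[of y1] y1_pos by auto
  then have z1': "y1 < z1" "z1 < y0" using z1 by auto
  obtain z2 where z2: "z2 > y0" "s z2 \<noteq> c" "\<forall>y\<ge>y0. avg b m y = 0 \<longleftrightarrow> y = z2"
    using avg_zero_beyond_peak[OF b m0] peak unfolding y0_def c_def s_def by auto
  have "\<forall>\<^sub>F e in at 0. card {u. limit_cycle (b - 1) b e \<mu> u} = 2 * card {z1, z2} + 1"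
  proof (rule card_limit_cycles_angle[OF b])
    show "\<forall>y>0. avg b \<bar>\<mu>\<bar> y = 0 \<longleftrightarrow> y \<in> {z1, z2}"
    proof (intro allI impI)
      fix y :: real assume y: "y > 0"
      consider "y \<le> y1" | "y1 < y" "y \<le> y0" | "y0 < y" by linarith
      then have "avg b m y = 0 \<longleftrightarrow> y = z1 \<or> y = z2"
      proof cases
        case 1
        then show ?thesis using neg[of y] y z1' z2 y0 y1 by auto
      next
        case 2
        then show ?thesis
          using incr[of y z1] incr[of z1 y] z1 z2 by (cases y z1 rule: linorder_cases) auto
      next
        case 3
        then show ?thesis using z2 z1 by auto
      qed
      then show "avg b \<bar>\<mu>\<bar> y = 0 \<longleftrightarrow> y \<in> {z1, z2}" by (simp add: m_def)
    qed
    have "s 0 \<noteq> c" "s z1 \<noteq> c" "s z2 \<noteq> c" using s0 sr[OF z1'] z2 by (auto simp: s_def)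
    then show "\<forall>z\<in>insert 0 {z1, z2}. angle \<bar>\<mu>\<bar> z + angle \<bar>\<mu>\<bar> (- z) \<noteq> pi * b"
      by (simp add: s_def m_def c_def)
  qed (use m z1' z2 y1_pos in \<open>auto simp: m_def\<close>)
  moreover have "z1 \<noteq> z2" using z1' z2 by auto
  ultimately show ?thesis by simp
qed

text \<open>\<open>avg\<close> is negative on all of \<open>y > 0\<close>: directly from
  \<open>m - 1\<close> on, and before that because its derivative increases while it vanishes at 0
  and is negative at \<open>m - 1\<close>.\<close>

lemma card_limit_cycles_strong:
  assumes b: "0 < b" "b < 1" and gt: "pi * b / sin (pi * b) < \<bar>\<mu>\<bar>"
  shows "\<forall>\<^sub>F e in at 0. card {u. limit_cycle (b - 1) b e \<mu> u} = 1"
proof -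
  define m c where "m = \<bar>\<mu>\<bar>" and "c = pi * b"
  have c: "0 < c" "c < pi" using b by (auto simp: c_def)
  note th = threshold_facts[OF c]
  have m2: "1 / cos (c / 2) < m" using gt th(6) by (simp add: m_def c_def)
  then have mc: "1 < m * cos (c / 2)" using th(1) by (simp add: field_simps)
  have m0: "m > 0" using m2 th(1) by (smt (verit) zero_less_divide_1_iff)
  have ms: "c < m * sin c" using gt th(4) by (simp add: m_def c_def field_simps)
  have outer: "avg b m y < 0" if "m - 1 \<le> y" for y
  proof -
    have "ramp_integral m (- y) = 0"
      using that angle_eq_0[OF m0, of "- y"] by (simp add: ramp_integral_angle[OF m0])
    \<comment> \<open>Testing with \<open>\<theta> = c\<close> cancels the terms in \<open>y\<close>
      and leaves the bound \<open>2 * (c - m * sin c)\<close> for \<open>avg\<close>.\<close>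
    moreover have "2 * ((y - 1) * c + m * sin c) \<le> ramp_integral m y"
      using c by (intro ramp_integral_ge) auto
    ultimately show ?thesis using ms by (simp add: avg_eq c_def algebra_simps)
  qed
  have neg: "avg b m y < 0" if y: "0 < y" for y
  proof (cases "m - 1 \<le> y")
    case False
    then have lt: "y < m - 1" by simp
    show ?thesis
    proof (rule ccontr)
      assume ge: "\<not> avg b m y < 0"
      \<comment> \<open>If \<open>avg\<close> were nonnegative at \<open>y\<close>, the mean value
        theorem on the two sides of \<open>y\<close> would give an earlier point with nonnegative
        derivative and a later one with negative derivative, against the decrease of the angle
        sum.\<close>
      obtain s where s: "0 < s" "s < y"
        "avg b m y - avg b m 0 = (y - 0) * (2 * (pi * b - angle m s - angle m (- s)))"
        using MVT2[OF y has_derivative_avg[OF m0]] by blast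
      obtain t where t: "y < t" "t < m - 1"
        "avg b m (m - 1) - avg b m y = (m - 1 - y) * (2 * (pi * b - angle m t - angle m (- t)))"
        using MVT2[OF lt has_derivative_avg[OF m0]] by blast
      have "0 \<le> y * (2 * (pi * b - angle m s - angle m (- s)))"
        using s(3) ge by (simp add: avg_eq[of b m 0])
      then have "angle m s + angle m (- s) \<le> pi * b" using y by (simp add: zero_le_mult_iff)
      moreover have "(m - 1 - y) * (2 * (pi * b - angle m t - angle m (- t))) < 0"
        using t(3) ge outer[of "m - 1"] by simp
      then have "pi * b < angle m t + angle m (- t)" using lt by (simp add: mult_less_0_iff)
      ultimately show False using angle_sum_strict_decreasing[of s t m] s t by simp
    qed
  qed (use outer in auto)
  have "c / 2 < angle m 0" using less_angle_iff[OF m0, of "c / 2" 0] mc c by simp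
  then have s0: "angle m 0 + angle m (- 0) \<noteq> c" by simp
  have "\<forall>\<^sub>F e in at 0. card {u. limit_cycle (b - 1) b e \<mu> u} = 2 * card ({} :: real set) + 1"
    using m0 s0 neg by (intro card_limit_cycles_angle[OF b]) (auto simp: m_def c_def less_le)
  then show ?thesis by simp
qed

theorem theorem6p1:
  fixes a b c \<mu>\<^sub>1 \<mu>\<^sub>2 :: real
  assumes ab: "a * b < 0"
  defines "c \<equiv> pi * b / (b - a)"
    and "\<mu>\<^sub>1 \<equiv> c / sin c"
    and "\<mu>\<^sub>2 \<equiv> 1 / cos (c / 2)"
  shows "0 < \<mu>\<^sub>2 \<and> \<mu>\<^sub>2 < \<mu>\<^sub>1 \<and>
    (\<forall>\<mu>::real. \<exists>\<epsilon>\<^sub>0>0. \<forall>\<epsilon>::real. 0 < \<bar>\<epsilon>\<bar> \<and> \<bar>\<epsilon>\<bar> < \<epsilon>\<^sub>0 \<longrightarrow>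
       (0 \<le> \<bar>\<mu>\<bar> \<and> \<bar>\<mu>\<bar> < \<mu>\<^sub>2 \<longrightarrow> card {u. limit_cycle a b \<epsilon> \<mu> u} = 3) \<and>
       (\<mu>\<^sub>2 < \<bar>\<mu>\<bar> \<and> \<bar>\<mu>\<bar> < \<mu>\<^sub>1 \<longrightarrow> card {u. limit_cycle a b \<epsilon> \<mu> u} = 5) \<and>
       (\<bar>\<mu>\<bar> > \<mu>\<^sub>1 \<longrightarrow> card {u. limit_cycle a b \<epsilon> \<mu> u} = 1))"
proof -
  define \<beta> where "\<beta> = b / (b - a)"
  have ne: "a \<noteq> b" using ab by (auto simp: mult_less_0_iff)
  have \<beta>: "0 < \<beta>" "\<beta> < 1"
    using ab by (auto simp: \<beta>_def mult_less_0_iff divide_less_eq zero_less_divide_iff)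
  have c_eq: "c = pi * \<beta>" by (simp add: c_def \<beta>_def)
  then have c: "0 < c" "c < pi" using \<beta> by auto
  note th = threshold_facts[OF c]
  have "\<exists>\<epsilon>\<^sub>0>0. \<forall>\<epsilon>::real. 0 < \<bar>\<epsilon>\<bar> \<and> \<bar>\<epsilon>\<bar> < \<epsilon>\<^sub>0 \<longrightarrow>
       (0 \<le> \<bar>\<mu>\<bar> \<and> \<bar>\<mu>\<bar> < \<mu>\<^sub>2 \<longrightarrow> card {u. limit_cycle a b \<epsilon> \<mu> u} = 3) \<and>
       (\<mu>\<^sub>2 < \<bar>\<mu>\<bar> \<and> \<bar>\<mu>\<bar> < \<mu>\<^sub>1 \<longrightarrow> card {u. limit_cycle a b \<epsilon> \<mu> u} = 5) \<and>
       (\<bar>\<mu>\<bar> > \<mu>\<^sub>1 \<longrightarrow> card {u. limit_cycle a b \<epsilon> \<mu> u} = 1)" for \<mu>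
  proof -
    let ?N = "\<lambda>e. card {u. limit_cycle (\<beta> - 1) \<beta> e \<mu> u}"
    have "\<forall>\<^sub>F e in at 0. \<bar>\<mu>\<bar> < \<mu>\<^sub>2 \<longrightarrow> ?N e = 3"
      using card_limit_cycles_weak[OF \<beta>, of \<mu>] by (cases "\<bar>\<mu>\<bar> < \<mu>\<^sub>2") (auto simp: \<mu>\<^sub>2_def c_eq)
    moreover have "\<forall>\<^sub>F e in at 0. \<mu>\<^sub>2 < \<bar>\<mu>\<bar> \<and> \<bar>\<mu>\<bar> < \<mu>\<^sub>1 \<longrightarrow> ?N e = 5"
      using card_limit_cycles_medium[OF \<beta>, of \<mu>]
      by (cases "\<mu>\<^sub>2 < \<bar>\<mu>\<bar> \<and> \<bar>\<mu>\<bar> < \<mu>\<^sub>1") (auto simp: \<mu>\<^sub>1_def \<mu>\<^sub>2_def c_eq)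
    moreover have "\<forall>\<^sub>F e in at 0. \<bar>\<mu>\<bar> > \<mu>\<^sub>1 \<longrightarrow> ?N e = 1"
      using card_limit_cycles_strong[OF \<beta>, of \<mu>] by (cases "\<bar>\<mu>\<bar> > \<mu>\<^sub>1") (auto simp: \<mu>\<^sub>1_def c_eq)
    ultimately have "\<forall>\<^sub>F e in at 0. (\<bar>\<mu>\<bar> < \<mu>\<^sub>2 \<longrightarrow> ?N e = 3) \<and>
        (\<mu>\<^sub>2 < \<bar>\<mu>\<bar> \<and> \<bar>\<mu>\<bar> < \<mu>\<^sub>1 \<longrightarrow> ?N e = 5) \<and> (\<bar>\<mu>\<bar> > \<mu>\<^sub>1 \<longrightarrow> ?N e = 1)"
      by (intro eventually_conj)
    then obtain d where d: "d > 0" and N: "\<And>e. e \<noteq> 0 \<Longrightarrow> \<bar>e\<bar> < d \<Longrightarrow> (\<bar>\<mu>\<bar> < \<mu>\<^sub>2 \<longrightarrow> ?N e = 3) \<and>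
        (\<mu>\<^sub>2 < \<bar>\<mu>\<bar> \<and> \<bar>\<mu>\<bar> < \<mu>\<^sub>1 \<longrightarrow> ?N e = 5) \<and> (\<bar>\<mu>\<bar> > \<mu>\<^sub>1 \<longrightarrow> ?N e = 1)"
      unfolding eventually_at by (auto simp: dist_real_def)
    show ?thesis
    \<comment> \<open>Normalisation turns \<epsilon> into \<open>\<epsilon> * (b - a)\<close>, so
      the bound for the normalised parameter is divided by \<open>\<bar>b - a\<bar>\<close>.\<close>
    proof (intro exI[of _ "d / \<bar>b - a\<bar>"] conjI allI impI)
      show "d / \<bar>b - a\<bar> > 0" using d ne by simp
      fix \<epsilon> assume "0 < \<bar>\<epsilon>\<bar> \<and> \<bar>\<epsilon>\<bar> < d / \<bar>b - a\<bar>"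
      then have "\<epsilon> * (b - a) \<noteq> 0" "\<bar>\<epsilon> * (b - a)\<bar> < d"
        using ne by (auto simp: abs_mult pos_less_divide_eq)
      note N' = N[OF this, folded limit_cycle_normalize[OF ne, of \<epsilon> \<mu>, folded \<beta>_def]]
      show "card {u. limit_cycle a b \<epsilon> \<mu> u} = 3" if "0 \<le> \<bar>\<mu>\<bar> \<and> \<bar>\<mu>\<bar> < \<mu>\<^sub>2" using N' that by blast
      show "card {u. limit_cycle a b \<epsilon> \<mu> u} = 5" if "\<mu>\<^sub>2 < \<bar>\<mu>\<bar> \<and> \<bar>\<mu>\<bar> < \<mu>\<^sub>1" using N' that by blast
      show "card {u. limit_cycle a b \<epsilon> \<mu> u} = 1" if "\<bar>\<mu>\<bar> > \<mu>\<^sub>1" using N' that by blast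
    qed
  qed
  then show ?thesis using th(1,6) by (auto simp: \<mu>\<^sub>1_def \<mu>\<^sub>2_def)
qed

end
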